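(* Let $n_1,\ldots,n_k$ be integers larger than or equal to $2$ and let $m=\prod_{i=1}^k n_i$. Suppose $\phi:M_m\to M_m$ is a linear map. Then $$\operatorname{rank}(\phi(A_1\otimes\cdots\otimes A_k))=1\quad\text{whenever}\quad\operatorname{rank}(A_1\otimes\cdots\otimes A_k)=1,\qquad A_i\in M_{n_i},\ i=1,\dots,k,$$ and $\phi(X_1\otimes\cdots\otimes X_k)$ is nonsingular for some $X_1\otimes\cdots\otimes X_k$ with $X_i\in M_{n_i}$, if and only if there exist nonsingular matrices $M,N\in M_m$ such that $$\phi(A_1\otimes\cdots\otimes A_k)=M(\psi_1(A_1)\otimes\cdots\otimes\psi_k(A_k))N\quad\text{for all }A_i\in M_{n_i},\ i=1,\dots,k,$$ where, for each $j=1,\dots,k$, $\psi_j:M_{n_j}\to M_{n_j}$ is either the identity map or the transpose map.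
   Context: $M_n$ is the space of $n\times n$ complex matrices; $\otimes$ is the Kronecker product, $A\otimes B=[a_{ij}B]$. *)

theory Defs
  imports "Jordan_Normal_Form.DL_Rank"
begin

(* In zero-based block indexing, row i of [a_{pq} B] lies in block row i div dim_row B,
   at offset i mod dim_row B inside the block; likewise for columns. *)
definition kron :: "'a :: times mat \<Rightarrow> 'a mat \<Rightarrow> 'a mat" (infixl \<open>\<Otimes>\<close> 70) where
  "A \<Otimes> B = mat (dim_row A * dim_row B) (dim_col A * dim_col B)
     (\<lambda>(i, j). A $$ (i div dim_row B, j div dim_col B) * B $$ (i mod dim_row B, j mod dim_col B))"

(* kron_prod A k = A 1 \<Otimes> ... \<Otimes> A k; the start value is the 1 x 1 identity,
   which is neutral for \<Otimes> (lemma kron_one_left). *)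
primrec kron_prod :: "(nat \<Rightarrow> 'a :: semiring_1 mat) \<Rightarrow> nat \<Rightarrow> 'a mat" where
  "kron_prod A 0 = 1\<^sub>m 1"
| "kron_prod A (Suc k) = kron_prod A k \<Otimes> A (Suc k)"

lemma kron_carrier:
  assumes "A \<in> carrier_mat r c" "B \<in> carrier_mat r' c'"
  shows "A \<Otimes> B \<in> carrier_mat (r * r') (c * c')"
  using assms by (auto simp: kron_def)

lemma kron_block_entry:
  assumes "A \<in> carrier_mat r c" "B \<in> carrier_mat r' c'"
    and "p < r" "q < c" "s < r'" "t < c'"
  shows "(A \<Otimes> B) $$ (p * r' + s, q * c' + t) = A $$ (p, q) * B $$ (s, t)"
proof -
  have lt: "x * b + y < a * b" if "x < a" "y < b" for x y a b :: nat
  proof -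
    have "x * b + y < Suc x * b" using that by simp
    also have "\<dots> \<le> a * b" using that by (intro mult_le_mono1) simp
    finally show ?thesis .
  qed
  show ?thesis using assms lt[of p r s r'] lt[of q c t c'] by (auto simp: kron_def)
qed

lemma kron_one_left: "1\<^sub>m 1 \<Otimes> A = (A :: 'a :: semiring_1 mat)"
  by (rule eq_matI) (auto simp: kron_def)

lemma kron_prod_carrier:
  assumes "\<And>i. i \<in> {1..k} \<Longrightarrow> A i \<in> carrier_mat (n i) (n i)"
  shows "kron_prod A k \<in> carrier_mat (\<Prod>i = 1..k. n i) (\<Prod>i = 1..k. n i)"
  using assms
proof (induction k)
  case (Suc k)
  have "kron_prod A k \<Otimes> A (Suc k)
      \<in> carrier_mat ((\<Prod>i = 1..k. n i) * n (Suc k)) ((\<Prod>i = 1..k. n i) * n (Suc k))"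
    using Suc by (intro kron_carrier) auto
  then show ?case by (simp add: mult.commute)
qed simp

lemma vectorspace_module_mat:
  "vectorspace class_ring (module_mat TYPE('a :: field) nr nc)"
proof -
  have "module class_ring (module_mat TYPE('a) nr nc)"
    by (intro moduleI fieldE(1)[OF class_field] abelian_group_mat)
       (auto simp: module_mat_simps add_smult_distrib_right_mat add_smult_distrib_left_mat)
  then show ?thesis
    using class_field by (simp add: vectorspace_def)
qed

(* The predicate linear_map (class_ring) (module_mat ...) constrains f on carrier_mat only. *)
lemma linear_map_mat_iff:
  "linear_map class_ring (module_mat TYPE('a :: field) r c) (module_mat TYPE('a) r' c') f \<longleftrightarrow>
     (\<forall>X \<in> carrier_mat r c. f X \<in> carrier_mat r' c') \<and>
     (\<forall>X \<in> carrier_mat r c. \<forall>Y \<in> carrier_mat r c. f (X + Y) = f X + f Y) \<and>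
     (\<forall>a. \<forall>X \<in> carrier_mat r c. f (a \<cdot>\<^sub>m X) = a \<cdot>\<^sub>m f X)"
  using vectorspace_module_mat[where 'a = 'a]
  by (auto simp: linear_map_def mod_hom_def mod_hom_axioms_def LinearCombinations.module_hom_def
      module_mat_simps vectorspace_def)

end

theory Submission
  imports Defs
begin

text \<open>Evaluated at matrices \<open>x\<^sub>j y\<^sub>j\<^sup>T\<close>, the map \<open>\<phi>\<close> is multilinear in the \<open>2 k\<close>
  vectors \<open>x\<^sub>j, y\<^sub>j\<close> and takes rank one values.  When a single vector varies, either the
  column space or the row space of the image stays fixed, and which of the two happens does not
  depend on the other vectors.  Hence \<open>\<phi> (\<dots>) = f (\<dots>) g (\<dots>)\<^sup>T\<close> for
  multilinear \<open>f\<close> and \<open>g\<close> in complementary sets of variables.  If \<open>x\<^sub>j\<close> and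
  \<open>y\<^sub>j\<close> were on the same side for some \<open>j\<close>, then every \<open>\<phi> (X\<^sub>1 \<otimes> \<dots> \<otimes> X\<^sub>k)\<close>
  would factor through a space of dimension smaller than \<open>m\<close>, so one nonsingular value
  forces \<open>x\<^sub>j\<close> and \<open>y\<^sub>j\<close> apart: \<open>\<psi>\<^sub>j\<close> is the identity or the transposition according
  to the side of \<open>x\<^sub>j\<close>.\<close>

section \<open>Multilinear maps with values of rank one\<close>

text \<open>The rank condition alone does not give the required form: for two factors of equal size,
  sending \<open>A \<Otimes> B\<close> to \<open>vec A (vec B)^T\<close> satisfies it too. The
  factorization must therefore allow \<open>x_j\<close> and \<open>y_j\<close> on the same side.
  Nonsingularity is spent only afterwards: once to exclude this by a dimension count, once to make
  \<open>M\<close> and \<open>N\<close> invertible.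

  The passage from \<open>f\<close> and \<open>g\<close> to matrices rests on this: a multilinear
  function is a matrix applied to the Kronecker product of its vectors, a 1 by 1 identity standing
  in for each absent vector. So \<open>f g^T\<close> becomes \<open>M (u v^T) N^T\<close>, and by
  the mixed product rule \<open>u v^T\<close> is a Kronecker product of columns (vectors of
  \<open>f\<close>) and rows (vectors of \<open>g\<close>). Column \<open>x\<close> with row
  \<open>y\<close> gives \<open>A = x y^T\<close>, row \<open>x\<close> with column \<open>y\<close>
  gives \<open>A^T\<close>. Matrix units have the form \<open>x y^T\<close>, so multilinearity in
  the matrices covers all of them.

  The bound \<open>2 \<le> n_j\<close> supplies a plane in every variable, which the comparison of
  types needs, and makes the loss of dimension strict.\<close>

text \<open>The space of vectors of dimension \<open>d\<close> consists of functions on \<open>nat\<close>, of which only the values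
  below \<open>d\<close> matter; this avoids carriers.\<close>

definition multilinear ::
    "'i set \<Rightarrow> ('i \<Rightarrow> nat) \<Rightarrow> (('i \<Rightarrow> nat \<Rightarrow> 'a::field) \<Rightarrow> 'c \<Rightarrow> 'a) \<Rightarrow> bool" where
  "multilinear I d F \<longleftrightarrow>
     (\<forall>z z'. (\<forall>i\<in>I. \<forall>t<d i. z i t = z' i t) \<longrightarrow> F z = F z') \<and>
     (\<forall>i\<in>I. \<forall>z x y a b c.
        F (z(i := \<lambda>t. a * x t + b * y t)) c = a * F (z(i := x)) c + b * F (z(i := y)) c)"

definition linear_fun :: "nat \<Rightarrow> ((nat \<Rightarrow> 'a::field) \<Rightarrow> 'c \<Rightarrow> 'a) \<Rightarrow> bool" where
  "linear_fun d h \<longleftrightarrow>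
     (\<forall>x y. (\<forall>t<d. x t = y t) \<longrightarrow> h x = h y) \<and>
     (\<forall>x y a b c. h (\<lambda>t. a * x t + b * y t) c = a * h x c + b * h y c)"

definition nonzero :: "nat \<Rightarrow> (nat \<Rightarrow> 'a::zero) \<Rightarrow> bool" where
  "nonzero d x \<longleftrightarrow> (\<exists>t<d. x t \<noteq> 0)"

definition outer :: "('r \<Rightarrow> 'a::times) \<Rightarrow> ('s \<Rightarrow> 'a) \<Rightarrow> 'r \<times> 's \<Rightarrow> 'a" where
  "outer u v = (\<lambda>(r, s). u r * v s)"

text \<open>The two index types stay independent, so that the transposed family, with
  \<open>'r\<close> and \<open>'s\<close> exchanged, falls under the same lemmas.\<close>

definition rank_one :: "('r \<times> 's \<Rightarrow> 'a::mult_zero) \<Rightarrow> bool" where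
  "rank_one G \<longleftrightarrow> (\<exists>u v. u \<noteq> (\<lambda>_. 0) \<and> v \<noteq> (\<lambda>_. 0) \<and> G = outer u v)"

definition unit_fun :: "nat \<Rightarrow> nat \<Rightarrow> 'a::zero_neq_one" where
  "unit_fun b = (\<lambda>t. if t = b then 1 else 0)"

lemma multilinear_local:
  "multilinear I d F \<Longrightarrow> (\<And>i t. i \<in> I \<Longrightarrow> t < d i \<Longrightarrow> z i t = z' i t) \<Longrightarrow> F z = F z'"
  by (simp add: multilinear_def)

lemma multilinear_comb:
  "multilinear I d F \<Longrightarrow> i \<in> I \<Longrightarrow>
     F (z(i := \<lambda>t. a * x t + b * y t)) c = a * F (z(i := x)) c + b * F (z(i := y)) c"
  by (simp add: multilinear_def)

lemma linear_fun_local: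
  "linear_fun d h \<Longrightarrow> (\<And>t. t < d \<Longrightarrow> x t = y t) \<Longrightarrow> h x = h y"
  by (simp add: linear_fun_def)

lemma linear_fun_comb:
  "linear_fun d h \<Longrightarrow> h (\<lambda>t. a * x t + b * y t) c = a * h x c + b * h y c"
  by (simp add: linear_fun_def)

lemma linear_fun_zero:
  assumes "linear_fun d h" "\<not> nonzero d x"
  shows "h x c = 0"
proof -
  have "h x = h (\<lambda>t. 0 * x t + 0 * x t)"
    using assms(2) by (intro linear_fun_local[OF assms(1)]) (auto simp: nonzero_def)
  then show ?thesis using linear_fun_comb[OF assms(1), of 0 x 0 x c] by simp
qed

lemma linear_fun_add:
  "linear_fun d h \<Longrightarrow> h (\<lambda>t. x t + y t) c = h x c + h y c"
  using linear_fun_comb[of d h 1 x 1 y c] by simp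

lemma multilinear_imp_linear_fun:
  assumes "multilinear I d F" "i \<in> I"
  shows "linear_fun (d i) (\<lambda>x. F (z(i := x)))"
  unfolding linear_fun_def
proof (intro conjI allI impI)
  fix x y :: "nat \<Rightarrow> 'b" assume "\<forall>t<d i. x t = y t"
  then show "F (z(i := x)) = F (z(i := y))"
    by (intro multilinear_local[OF assms(1)]) auto
qed (simp add: multilinear_comb[OF assms])

lemma multilinear_zero:
  assumes "multilinear I d F" "i \<in> I" "\<not> nonzero (d i) (z i)"
  shows "F z c = 0"
  using linear_fun_zero[OF multilinear_imp_linear_fun[OF assms(1,2)] assms(3), of z c] by simp

section \<open>Outer products and proportional vectors\<close>

lemma outer_apply [simp]: "outer u v (r, s) = u r * v s"
  by (simp add: outer_def)

lemma rank_one_outerE: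
  assumes "rank_one G"
  obtains u v where "u \<noteq> (\<lambda>_. 0)" "v \<noteq> (\<lambda>_. 0)" "G = outer u v"
  using assms by (auto simp: rank_one_def)

text \<open>Linear dependence of the pair, as vanishing of all minors of size two. The zero vector
  is parallel to everything, hence the condition on \<open>u\<close> in
  \<open>parallelE\<close>.\<close>

definition parallel :: "('r \<Rightarrow> 'a::times) \<Rightarrow> ('r \<Rightarrow> 'a) \<Rightarrow> bool" where
  "parallel u v \<longleftrightarrow> (\<forall>r r'. u r * v r' = u r' * v r)"

lemma parallel_sym: "parallel u v \<Longrightarrow> parallel v (u :: 'r \<Rightarrow> 'a::field)"
  unfolding parallel_def by (metis mult.commute)

lemma parallelE:
  fixes u v :: "'r \<Rightarrow> 'a::field"
  assumes "parallel u v" "u \<noteq> (\<lambda>_. 0)"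
  obtains c where "v = (\<lambda>r. c * u r)"
proof -
  obtain p where p: "u p \<noteq> 0" using assms(2) by auto
  have "v = (\<lambda>r. (v p / u p) * u r)"
  proof
    fix r
    have "u p * v r = u r * v p" using assms(1) by (simp add: parallel_def)
    then show "v r = (v p / u p) * u r" using p by (simp add: field_simps)
  qed
  then show thesis using that by blast
qed

lemma outer_eq_outer:
  fixes u :: "'r \<Rightarrow> 'a::field"
  assumes "outer u v = outer u' v'" "u \<noteq> (\<lambda>_. 0)" "v \<noteq> (\<lambda>_. 0)"
  obtains c where "c \<noteq> 0" "v' = (\<lambda>s. c * v s)"
proof -
  have e: "u r * v s = u' r * v' s" for r s
    using fun_cong[OF assms(1), of "(r, s)"] by simp
  obtain p where p: "u p \<noteq> 0" using assms(2) by auto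
  obtain q where q: "v q \<noteq> 0" using assms(3) by auto
  have u': "u' p \<noteq> 0" using e[of p q] p q by auto
  show thesis
  proof
    show "u p / u' p \<noteq> 0" using p u' by simp
    show "v' = (\<lambda>s. u p / u' p * v s)"
      using e[of p] u' by (auto simp: field_simps)
  qed
qed

text \<open>Every minor of size two of \<open>u v\<^sup>T + u' v'\<^sup>T\<close> is the product of a minor of \<open>(u, u')\<close> and one
  of \<open>(v, v')\<close>.\<close>

lemma outer_sum_parallel:
  fixes u u' p :: "'r \<Rightarrow> 'a::field" and v v' q :: "'s \<Rightarrow> 'a"
  assumes "\<And>r s. u r * v s + u' r * v' s = p r * q s"
  shows "parallel u u' \<or> parallel v v'"
proof -
  have "(u r * u' r' - u r' * u' r) * (v s * v' s' - v s' * v' s) = 0" for r r' s s'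
  proof -
    have "(u r * u' r' - u r' * u' r) * (v s * v' s' - v s' * v' s) =
        (u r * v s + u' r * v' s) * (u r' * v s' + u' r' * v' s')
      - (u r * v s' + u' r * v' s') * (u r' * v s + u' r' * v' s)"
      by (simp add: algebra_simps)
    also have "\<dots> = 0" unfolding assms by (simp add: mult_ac)
    finally show ?thesis .
  qed
  then have "u r * u' r' = u r' * u' r \<or> v s * v' s' = v s' * v' s" for r r' s s'
    by simp
  then show ?thesis unfolding parallel_def by blast
qed

text \<open>At a zero vector the value is 0, again an outer product. Sums such as
  \<open>x + y\<close> can thus be used without knowing that they are nonzero.\<close>

lemma rank_le_oneE:
  assumes "linear_fun d h" "\<And>x. nonzero d x \<Longrightarrow> rank_one (h x)"
  obtains p q where "h x = outer p q"
proof (cases "nonzero d x")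
  case True
  then show thesis using assms(2) that rank_one_outerE by metis
next
  case False
  have "h x = outer (\<lambda>_. 0) (\<lambda>_. 0)"
    using linear_fun_zero[OF assms(1) False] by auto
  then show thesis using that by blast
qed

text \<open>A linear space of matrices of rank at most one has a common row factor or a common
  column factor. If \<open>x1\<close> breaks the first and \<open>x2\<close> the second, then adding
  each to \<open>x0\<close> forces \<open>h x1\<close> to share the column factor \<open>u\<close>
  and \<open>h x2\<close> to share the row factor \<open>v\<close>; the sum of \<open>h x1\<close>
  and \<open>h x2\<close> then has rank two.\<close>

lemma linear_rank_one_cases:
  fixes h :: "(nat \<Rightarrow> 'a::field) \<Rightarrow> 'r \<times> 's \<Rightarrow> 'a"
  assumes lin: "linear_fun d h" and rk: "\<And>x. nonzero d x \<Longrightarrow> rank_one (h x)"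
    and x0: "h x0 = outer u v" "u \<noteq> (\<lambda>_. 0)" "v \<noteq> (\<lambda>_. 0)"
  shows "(\<forall>x. \<exists>w. h x = outer w v) \<or> (\<forall>x. \<exists>w. h x = outer u w)"
proof (rule ccontr)
  assume "\<not> ?thesis"
  then obtain x1 x2 where n1: "\<And>w. h x1 \<noteq> outer w v" and n2: "\<And>w. h x2 \<noteq> outer u w" by blast
  obtain p1 q1 where h1: "h x1 = outer p1 q1" using rank_le_oneE[OF lin rk] .
  obtain p2 q2 where h2: "h x2 = outer p2 q2" using rank_le_oneE[OF lin rk] .
  have par: "parallel a a' \<or> parallel b b'" if "h x = outer a b" "h y = outer a' b'" for x y a b a' b'
  proof -
    obtain p q where "h (\<lambda>t. x t + y t) = outer p q" using rank_le_oneE[OF lin rk] .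
    then show ?thesis
      using linear_fun_add[OF lin, of x y] that
      by (intro outer_sum_parallel[of a b a' b' p q]) (metis outer_apply)
  qed
  have nq1: "\<not> parallel v q1"
  proof
    assume "parallel v q1"
    then obtain c where "q1 = (\<lambda>r. c * v r)" using parallelE x0(3) by blast
    then have "h x1 = outer (\<lambda>r. p1 r * c) v" using h1 by (auto simp: outer_def)
    then show False using n1 by blast
  qed
  have np2: "\<not> parallel u p2"
  proof
    assume "parallel u p2"
    then obtain c where "p2 = (\<lambda>r. c * u r)" using parallelE x0(2) by blast
    then have "h x2 = outer u (\<lambda>r. c * q2 r)" using h2 by (auto simp: outer_def mult_ac)
    then show False using n2 by blast
  qed
  have "parallel u p1" using par[OF x0(1) h1] nq1 by blast
  then obtain c where c: "p1 = (\<lambda>r. c * u r)" using parallelE x0(2) by blast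
  \<comment> \<open>Otherwise \<open>h x1\<close> is zero and has the excluded form with
    \<open>w = 0\<close>.\<close>
  have "c \<noteq> 0" using n1[of "\<lambda>_. 0"] h1 c by (auto simp: outer_def)
  have "parallel v q2" using par[OF x0(1) h2] np2 by blast
  then obtain b where b: "q2 = (\<lambda>r. b * v r)" using parallelE x0(3) by blast
  have "b \<noteq> 0" using n2[of "\<lambda>_. 0"] h2 b by (auto simp: outer_def)
  from par[OF h1 h2] show False
  proof
    assume "parallel p1 p2"
    then have "parallel u p2" using c \<open>c \<noteq> 0\<close> by (simp add: parallel_def)
    with np2 show False ..
  next
    assume "parallel q1 q2"
    then have "parallel v q1" using b \<open>b \<noteq> 0\<close> by (simp add: parallel_def mult.commute)
    with nq1 show False ..
  qed
qed

text \<open>Values of rank one are nonzero, so \<open>h\<close> has trivial kernel; it kills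
  \<open>b x - a y\<close>, and it kills \<open>x\<close> itself if \<open>a = 0\<close>.\<close>

lemma dependent_of_proportional_images:
  fixes h :: "(nat \<Rightarrow> 'a::field) \<Rightarrow> 'r \<times> 's \<Rightarrow> 'a"
  assumes lin: "linear_fun d h" and rk: "\<And>x. nonzero d x \<Longrightarrow> rank_one (h x)"
    and "\<And>c. h x c = a * K c" "\<And>c. h y c = b * K c"
  shows "\<exists>\<alpha> \<beta>. (\<alpha> \<noteq> 0 \<or> \<beta> \<noteq> 0) \<and> \<not> nonzero d (\<lambda>t. \<alpha> * x t + \<beta> * y t)"
proof -
  have nz: "\<not> nonzero d z" if "\<And>c. h z c = 0" for z
  proof
    assume "nonzero d z"
    then obtain u v where uv: "u \<noteq> (\<lambda>_. 0)" "v \<noteq> (\<lambda>_. 0)" "h z = outer u v"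
      using rk rank_one_outerE by metis
    then obtain p q where "u p \<noteq> 0" "v q \<noteq> 0" by (auto simp: fun_eq_iff)
    then show False using that[of "(p, q)"] uv(3) by auto
  qed
  show ?thesis
  proof (cases "a = 0")
    case True
    then have "\<not> nonzero d (\<lambda>t. 1 * x t + 0 * y t)" using nz[of x] assms(3) by simp
    then show ?thesis by (intro exI[of _ 1] exI[of _ 0] conjI) simp_all
  next
    case False
    have "\<not> nonzero d (\<lambda>t. b * x t + (- a) * y t)"
      by (rule nz) (simp only: linear_fun_comb[OF lin] assms(3,4), simp)
    then show ?thesis using False by (intro exI[of _ b] exI[of _ "- a"] conjI) simp_all
  qed
qed

text \<open>If the types differed at \<open>x\<close> and \<open>x'\<close>, then for every \<open>z\<close> one of
  \<open>B x z\<close>, \<open>B x' z\<close> would lie on a fixed line; among three vectors of a plane,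
  pairwise independent, two lie on the same side, against injectivity.\<close>

lemma common_row_factor_transfer:
  fixes B :: "(nat \<Rightarrow> 'a::field) \<Rightarrow> (nat \<Rightarrow> 'a) \<Rightarrow> 'r \<times> 's \<Rightarrow> 'a"
  assumes lin1: "\<And>z. linear_fun e (\<lambda>x. B x z)" and lin2: "\<And>x. linear_fun d (B x)"
    and rk: "\<And>x z. nonzero e x \<Longrightarrow> nonzero d z \<Longrightarrow> rank_one (B x z)"
    and d: "2 \<le> d" and x: "nonzero e x" and x': "nonzero e x'"
    and v: "v \<noteq> (\<lambda>_. 0)" "\<forall>z. \<exists>w. B x z = outer w v"
  shows "\<exists>v'. v' \<noteq> (\<lambda>_. 0) \<and> (\<forall>z. \<exists>w. B x' z = outer w v')"
proof -
  have nz0: "nonzero d (unit_fun 0)" using d by (auto simp: nonzero_def unit_fun_def)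
  obtain u' v' where uv': "u' \<noteq> (\<lambda>_. 0)" "v' \<noteq> (\<lambda>_. 0)" "B x' (unit_fun 0) = outer u' v'"
    using rk[OF x' nz0] rank_one_outerE by metis
  have "\<not> (\<forall>z. \<exists>w. B x' z = outer u' w)"
  proof
    assume R: "\<forall>z. \<exists>w. B x' z = outer u' w"
    let ?P = "\<lambda>y z. \<exists>a. \<forall>c. B y z c = a * outer u' v c"
    \<comment> \<open>The matrices at \<open>x\<close> and \<open>x'\<close> have the shapes
      \<open>f v^T\<close> and \<open>u' g^T\<close>. Their sum has rank at most one, so one of the
      two is a multiple of \<open>u' v^T\<close>.\<close>
    have alt: "?P x z \<or> ?P x' z" for z
    proof -
      obtain f where f: "B x z = outer f v" using v(2) by blast
      obtain g where g: "B x' z = outer u' g" using R by blast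
      have "\<exists>p q. B (\<lambda>t. x t + x' t) z = outer p q"
      proof (cases "nonzero d z")
        case True
        then show ?thesis using rank_le_oneE[OF lin1, of z] rk by metis
      next
        case False
        then have "B (\<lambda>t. x t + x' t) z = outer (\<lambda>_. 0) (\<lambda>_. 0)"
          using linear_fun_zero[OF lin2] by auto
        then show ?thesis by blast
      qed
      then obtain p q where pq: "B (\<lambda>t. x t + x' t) z = outer p q" by blast
      have "f r * v s + u' r * g s = p r * q s" for r s
        using linear_fun_add[OF lin1, of x x' z "(r, s)"] f g pq by simp
      then have "parallel f u' \<or> parallel v g" by (rule outer_sum_parallel)
      then show ?thesis
      proof
        assume "parallel f u'"
        then obtain c where "f = (\<lambda>r. c * u' r)"
          using parallelE[OF parallel_sym uv'(1)] by blast
        then show ?thesis using f by (auto intro!: exI[of _ c])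
      next
        assume "parallel v g"
        then obtain c where "g = (\<lambda>r. c * v r)" using parallelE v(1) by blast
        then show ?thesis using g by (auto intro!: exI[of _ c])
      qed
    qed
    let ?ind = "\<lambda>z1 z2. \<forall>\<alpha> \<beta>. \<not> nonzero d (\<lambda>t. \<alpha> * z1 t + \<beta> * z2 t) \<longrightarrow> \<alpha> = 0 \<and> \<beta> = 0"
    have no: "\<not> (?P x z1 \<and> ?P x z2) \<and> \<not> (?P x' z1 \<and> ?P x' z2)" if ind: "?ind z1 z2" for z1 z2
    proof -
      have "\<not> (?P y z1 \<and> ?P y z2)" if y: "nonzero e y" for y
      proof
        assume "?P y z1 \<and> ?P y z2"
        then obtain a b where ab: "\<And>c. B y z1 c = a * outer u' v c" "\<And>c. B y z2 c = b * outer u' v c"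
          by blast
        show False
          using dependent_of_proportional_images[OF lin2 rk[OF y] ab] ind by blast
      qed
      then show ?thesis using x x' by blast
    qed
    \<comment> \<open>These three vectors are pairwise independent over every field, including the
      one with two elements.\<close>
    let ?e1 = "unit_fun 0 :: nat \<Rightarrow> 'a" and ?e2 = "unit_fun 1 :: nat \<Rightarrow> 'a"
    let ?e3 = "\<lambda>t. ?e1 t + ?e2 t"
    have coord: "x 0 = 0 \<and> x 1 = 0" if "\<not> nonzero d x" for x :: "nat \<Rightarrow> 'a"
      using that d by (auto simp: nonzero_def)
    have "?ind ?e1 ?e2" "?ind ?e1 ?e3" "?ind ?e2 ?e3"
      by (auto dest!: coord simp: unit_fun_def)
    note no[OF this(1)] no[OF this(2)] no[OF this(3)]
    then show False
      using alt[of ?e1] alt[of ?e2] alt[of ?e3] by blast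
  qed
  then have "\<forall>z. \<exists>w. B x' z = outer w v'"
    using linear_rank_one_cases[OF lin2 rk[OF x'] uv'(3,1,2)] by blast
  then show ?thesis using uv'(2) by blast
qed

section \<open>Adding one variable to a factorization\<close>

lemma multilinear_fix_slot:
  fixes F :: "('i \<Rightarrow> nat \<Rightarrow> 'a::field) \<Rightarrow> 'c \<Rightarrow> 'a"
  assumes F: "multilinear I d F"
  shows "multilinear (I - {w}) d (\<lambda>z. F (z(w := e)))"
  unfolding multilinear_def
proof (intro conjI allI impI ballI)
  fix z z' :: "'i \<Rightarrow> nat \<Rightarrow> 'a" assume "\<forall>i\<in>I - {w}. \<forall>t<d i. z i t = z' i t"
  then show "F (z(w := e)) = F (z'(w := e))" by (intro multilinear_local[OF F]) auto
next
  fix i z x y a b c assume i: "i \<in> I - {w}"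
  then have "i \<noteq> w" by simp
  show "F (z(i := \<lambda>t. a * x t + b * y t, w := e)) c
      = a * F (z(i := x, w := e)) c + b * F (z(i := y, w := e)) c"
    unfolding fun_upd_twist[OF \<open>i \<noteq> w\<close>] by (rule multilinear_comb[OF F]) (use i in simp)
qed

text \<open>The left factor at \<open>z\<close> does not change with a variable of \<open>g0\<close>: compare its values at \<open>x\<close>,
  \<open>y\<close> and \<open>x + y\<close>, where \<open>g0\<close> takes independent values at \<open>x\<close> and \<open>y\<close>.  It can therefore be
  computed with these variables frozen.\<close>

lemma factor_last_slot:
  fixes F :: "('i \<Rightarrow> nat \<Rightarrow> 'a::field) \<Rightarrow> 'r \<times> 's \<Rightarrow> 'a"
  assumes J: "finite J" "w \<notin> J" and d: "\<And>i. i \<in> insert w J \<Longrightarrow> 2 \<le> d i"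
    and F: "multilinear (insert w J) d F"
    and rk: "\<And>z. (\<And>i. i \<in> insert w J \<Longrightarrow> nonzero (d i) (z i)) \<Longrightarrow> rank_one (F z)"
    and L: "L \<subseteq> J" and g0: "multilinear (J - L) d g0"
    and fac: "\<And>z. F (z(w := unit_fun 0)) = outer (f0 z) (g0 z)"
    and row: "\<And>z. (\<And>i. i \<in> J \<Longrightarrow> nonzero (d i) (z i)) \<Longrightarrow>
      \<exists>v. v \<noteq> (\<lambda>_. 0) \<and> (\<forall>x. \<exists>u. F (z(w := x)) = outer u v)"
  shows "\<exists>f. multilinear (insert w L) d f \<and> (\<forall>z. F z = outer (f z) (g0 z))"
proof -
  let ?e = "unit_fun 0 :: nat \<Rightarrow> 'a"
  define nz where "nz z \<longleftrightarrow> (\<forall>i\<in>J. nonzero (d i) (z i))" for z :: "'i \<Rightarrow> nat \<Rightarrow> 'a"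
  have e: "nonzero (d i) ?e" if "i \<in> insert w J" for i
    using d[OF that] by (auto simp: nonzero_def unit_fun_def)
  have nz_upd: "nz (z(i := x))" if "nz z" "nonzero (d i) x" for z i x
    using that by (auto simp: nz_def)
  have rk_e: "rank_one (F (z(w := ?e)))" if "nz z" for z
    using that e J by (intro rk) (auto simp: nz_def)
  have g0_ne: "g0 z \<noteq> (\<lambda>_. 0)" if z: "nz z" for z
  proof
    assume g: "g0 z = (\<lambda>_. 0)"
    obtain u v where uv: "u \<noteq> (\<lambda>_. 0)" "v \<noteq> (\<lambda>_. 0)" "F (z(w := ?e)) = outer u v"
      using rank_one_outerE[OF rk_e[OF z]] .
    then obtain p q where "u p \<noteq> 0" "v q \<noteq> 0" by (auto simp: fun_eq_iff)
    moreover have "outer u v (p, q) = outer (f0 z) (g0 z) (p, q)" using fac uv(3) by simp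
    ultimately show False using g by simp
  qed
  \<comment> \<open>At \<open>w := unit_fun 0\<close> the common row factor from \<open>row\<close>
    meets the known factorization, so it is a nonzero multiple of \<open>g0 z\<close>.\<close>
  have row_g0: "\<exists>u. F z = outer u (g0 z)" if z: "nz z" for z
  proof -
    obtain v where v: "v \<noteq> (\<lambda>_. 0)" "\<And>x. \<exists>u. F (z(w := x)) = outer u v"
      using row[of z] z by (auto simp: nz_def)
    obtain u1 where u1: "F (z(w := ?e)) = outer u1 v" using v(2) by blast
    have u1_ne: "u1 \<noteq> (\<lambda>_. 0)"
    proof
      assume "u1 = (\<lambda>_. 0)"
      then have z0: "F (z(w := ?e)) (p, q) = 0" for p q using u1 by simp
      obtain u' v' where uv: "u' \<noteq> (\<lambda>_. 0)" "v' \<noteq> (\<lambda>_. 0)" "F (z(w := ?e)) = outer u' v'"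
        using rank_one_outerE[OF rk_e[OF z]] .
      then obtain p q where "u' p \<noteq> 0" "v' q \<noteq> 0" by (auto simp: fun_eq_iff)
      then show False using z0[of p q] uv(3) by simp
    qed
    have "outer u1 v = outer (f0 z) (g0 z)" using u1 fac by simp
    then obtain c where c: "c \<noteq> 0" "g0 z = (\<lambda>s. c * v s)"
      using u1_ne v(1) by (rule outer_eq_outer)
    obtain u where "F (z(w := z w)) = outer u v" using v(2) by blast
    then have "F z = outer (\<lambda>r. u r / c) (g0 z)" using c by (auto simp: outer_def)
    then show ?thesis by blast
  qed
  have step: "F (z(i := x)) = outer u (g0 (z(i := x)))"
    if z: "nz z" and i: "i \<in> J - L" and x: "nonzero (d i) x" and u: "F z = outer u (g0 z)" for z i x u
  proof -
    let ?g = "g0 z" and ?g' = "g0 (z(i := x))"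
    have iF: "i \<in> insert w J" using i by simp
    obtain u' where u': "F (z(i := x)) = outer u' ?g'" using row_g0[OF nz_upd[OF z x]] by blast
    show ?thesis
    proof (cases "parallel ?g ?g'")
      case True
      then obtain c where c: "?g' = (\<lambda>r. c * ?g r)" using parallelE g0_ne[OF z] by blast
      \<comment> \<open>\<open>g0\<close> vanishes at no family of nonzero vectors, so
        \<open>x\<close> must be \<open>c\<close> times \<open>z i\<close>; both \<open>F\<close>
        and \<open>g0\<close> then scale by \<open>c\<close>, and \<open>u\<close> survives.\<close>
      have "g0 (z(i := \<lambda>t. 1 * x t + (- c) * z i t)) = (\<lambda>_. 0)"
        by (rule ext) (simp only: multilinear_comb[OF g0 i], simp add: c)
      then have "\<not> nonzero (d i) (\<lambda>t. 1 * x t + (- c) * z i t)"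
        using g0_ne nz_upd[OF z] by metis
      then have xt: "x t = c * z i t" if "t < d i" for t using that by (auto simp: nonzero_def)
      have "F (z(i := x)) = F (z(i := \<lambda>t. c * z i t + 0 * z i t))"
        using xt by (intro multilinear_local[OF F]) auto
      then have "F (z(i := x)) p = c * F z p" for p
        using multilinear_comb[OF F iF, of z c "z i" 0 "z i" p] by simp
      then show ?thesis using u c by (auto simp: outer_def mult_ac)
    next
      case False
      let ?y = "\<lambda>t. 1 * z i t + 1 * x t"
      have gy: "g0 (z(i := ?y)) s = ?g s + ?g' s" for s
        by (simp only: multilinear_comb[OF g0 i]) simp
      have "nonzero (d i) ?y"
      proof (rule ccontr)
        assume "\<not> nonzero (d i) ?y"
        then have "g0 (z(i := ?y)) s = 0" for s
          using multilinear_zero[OF g0 i, of "z(i := ?y)"] by simp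
        then have "?g' s = - ?g s" for s using gy by (simp add: eq_neg_iff_add_eq_0 add.commute)
        then show False using False by (simp add: parallel_def)
      qed
      then obtain u'' where u'': "F (z(i := ?y)) = outer u'' (g0 (z(i := ?y)))"
        using row_g0 nz_upd[OF z] by blast
      have comb: "(u'' r - u r) * ?g s + (u'' r - u' r) * ?g' s = 0" for r s
      proof -
        have "u'' r * (?g s + ?g' s) = F (z(i := ?y)) (r, s)" by (simp only: u'' outer_apply gy)
        also have "\<dots> = u r * ?g s + u' r * ?g' s"
          by (simp only: multilinear_comb[OF F iF]) (simp add: u u')
        finally show ?thesis by (simp add: algebra_simps)
      qed
      obtain s1 s2 where s: "?g s1 * ?g' s2 \<noteq> ?g s2 * ?g' s1"
        using False by (auto simp: parallel_def)
      have "u r = u' r" for r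
      proof -
        \<comment> \<open>Cramer's rule for \<open>comb\<close> at \<open>s1\<close> and
          \<open>s2\<close>: the determinant is nonzero, so both unknowns \<open>u'' r - u r\<close>
          and \<open>u'' r - u' r\<close> vanish.\<close>
        have "(u'' r - u r) * (?g s1 * ?g' s2 - ?g s2 * ?g' s1) =
            ((u'' r - u r) * ?g s1 + (u'' r - u' r) * ?g' s1) * ?g' s2
          - ((u'' r - u r) * ?g s2 + (u'' r - u' r) * ?g' s2) * ?g' s1"
          by (simp add: algebra_simps)
        then have 1: "u'' r = u r" using s unfolding comb by simp
        have "(u'' r - u' r) * (?g s1 * ?g' s2 - ?g s2 * ?g' s1) =
            ((u'' r - u r) * ?g s2 + (u'' r - u' r) * ?g' s2) * ?g s1
          - ((u'' r - u r) * ?g s1 + (u'' r - u' r) * ?g' s1) * ?g s2"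
          by (simp add: algebra_simps)
        then have "u'' r = u' r" using s unfolding comb by simp
        with 1 show ?thesis by simp
      qed
      then show ?thesis using u' by presburger
    qed
  qed
  \<comment> \<open>The variables of \<open>g0\<close> are frozen one by one; \<open>nz\<close> is
    carried along because \<open>step\<close> applies only to nonzero vectors.\<close>
  have override: "F (\<lambda>i. if i \<in> K then ?e else z i) = outer u (g0 (\<lambda>i. if i \<in> K then ?e else z i)) \<and>
      nz (\<lambda>i. if i \<in> K then ?e else z i)"
    if z: "nz z" and u: "F z = outer u (g0 z)" and K: "K \<subseteq> J - L" for z u K
    using finite_subset[OF K finite_Diff[OF J(1)]] K
  proof (induction K rule: finite_induct)
    case empty
    then show ?case using z u by simp
  next
    case (insert i K)
    let ?z = "\<lambda>i. if i \<in> K then ?e else z i"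
    have "(\<lambda>j. if j \<in> insert i K then ?e else z j) = ?z(i := ?e)" by auto
    moreover have "nonzero (d i) ?e" using e insert.prems by blast
    ultimately show ?case using step[of ?z i ?e u] nz_upd[of ?z i ?e] insert by auto
  qed
  define \<beta> where "\<beta> z = (\<lambda>i. if i \<in> J - L then ?e else z i)" for z
  have \<beta>_upd: "\<beta> (z(i := x)) = (\<beta> z)(i := x)" if "i \<in> insert w L" for z i x
    using that L J by (auto simp: \<beta>_def)
  define \<gamma> where "\<gamma> = g0 (\<lambda>_. ?e)"
  have g0_\<beta>: "g0 (\<beta> z) = \<gamma>" for z
    unfolding \<gamma>_def by (rule multilinear_local[OF g0]) (simp add: \<beta>_def)
  have "nz (\<lambda>_. ?e)" using e by (simp add: nz_def)
  then obtain s0 where s0: "\<gamma> s0 \<noteq> 0" using g0_ne[of "\<lambda>_. ?e"] by (auto simp: \<gamma>_def fun_eq_iff)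
  \<comment> \<open>With the variables of \<open>g0\<close> frozen, the row factor is the constant
    \<open>\<gamma>\<close>. Column \<open>s0\<close>, where it is nonzero, then yields the left
    factor by an expression linear in \<open>F\<close>.\<close>
  define f where "f z r = F (\<beta> z) (r, s0) / \<gamma> s0" for z r
  have f: "multilinear (insert w L) d f"
    unfolding multilinear_def
  proof (intro conjI allI impI ballI)
    fix z z' :: "'i \<Rightarrow> nat \<Rightarrow> 'a"
    assume "\<forall>i\<in>insert w L. \<forall>t<d i. z i t = z' i t"
    then have "F (\<beta> z) = F (\<beta> z')" by (intro multilinear_local[OF F]) (auto simp: \<beta>_def)
    then show "f z = f z'" by (intro ext) (simp add: f_def)
  next
    fix i z x y a b r assume i: "i \<in> insert w L"
    then have "i \<in> insert w J" using L by blast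
    then show "f (z(i := \<lambda>t. a * x t + b * y t)) r = a * f (z(i := x)) r + b * f (z(i := y)) r"
      unfolding f_def \<beta>_upd[OF i] by (simp add: multilinear_comb[OF F] add_divide_distrib)
  qed
  have "F z = outer (f z) (g0 z)" for z
  proof (cases "nz z")
    case True
    then obtain u where u: "F z = outer u (g0 z)" using row_g0 by blast
    have "F (\<beta> z) = outer u \<gamma>"
      using override[OF True u subset_refl] g0_\<beta> by (simp add: \<beta>_def)
    then have "f z = u" using s0 by (auto simp: f_def)
    then show ?thesis using u by simp
  next
    case False
    \<comment> \<open>A zero vector in slot \<open>i\<close> annihilates \<open>F\<close>, and also
      \<open>f\<close> or \<open>g0\<close>, whichever contains the slot.\<close>
    then obtain i where i: "i \<in> J" "\<not> nonzero (d i) (z i)" by (auto simp: nz_def)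
    have "F z p = 0" for p using multilinear_zero[OF F, of i z] i by simp
    moreover have "outer (f z) (g0 z) p = 0" for p
    proof (cases "i \<in> L")
      case True
      then show ?thesis using multilinear_zero[OF f, of i z] i(2) by (cases p) simp
    next
      case False
      then show ?thesis using multilinear_zero[OF g0, of i z] i by (cases p) simp
    qed
    ultimately show ?thesis by (intro ext) simp
  qed
  then show ?thesis using f by blast
qed

text \<open>The family \<open>z\<close> is changed into \<open>z'\<close> one vector at a time. Each
  change involves only the two variables \<open>i\<close> and \<open>w\<close>, which is the
  situation of \<open>common_row_factor_transfer\<close>.\<close>

lemma common_row_factor_everywhere:
  fixes F :: "('i \<Rightarrow> nat \<Rightarrow> 'a::field) \<Rightarrow> 'r \<times> 's \<Rightarrow> 'a"
  assumes J: "finite J" "w \<notin> J" and d: "\<And>i. i \<in> insert w J \<Longrightarrow> 2 \<le> d i"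
    and F: "multilinear (insert w J) d F"
    and rk: "\<And>z. (\<And>i. i \<in> insert w J \<Longrightarrow> nonzero (d i) (z i)) \<Longrightarrow> rank_one (F z)"
    and z: "\<And>i. i \<in> J \<Longrightarrow> nonzero (d i) (z i)" and z': "\<And>i. i \<in> J \<Longrightarrow> nonzero (d i) (z' i)"
    and row: "\<exists>v. v \<noteq> (\<lambda>_. 0) \<and> (\<forall>x. \<exists>u. F (z(w := x)) = outer u v)"
  shows "\<exists>v. v \<noteq> (\<lambda>_. 0) \<and> (\<forall>x. \<exists>u. F (z'(w := x)) = outer u v)"
proof -
  have "\<exists>v. v \<noteq> (\<lambda>_. 0) \<and> (\<forall>x. \<exists>u. F ((\<lambda>i. if i \<in> K then z' i else z i)(w := x)) = outer u v)"
    if "K \<subseteq> J" for K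
    using finite_subset[OF that J(1)] that
  proof (induction K rule: finite_induct)
    case empty
    show ?case using row by (simp only: empty_iff if_False)
  next
    case (insert i K)
    let ?z = "\<lambda>i. if i \<in> K then z' i else z i"
    let ?B = "\<lambda>x y. F (?z(i := x, w := y))"
    have i: "i \<in> J" "i \<noteq> w" using insert.prems J by auto
    have upd: "?z = ?z(i := z i)" "(\<lambda>j. if j \<in> insert i K then z' j else z j) = ?z(i := z' i)"
      using insert.hyps by auto
    obtain v where v: "v \<noteq> (\<lambda>_. 0)" "\<And>x. \<exists>u. F (?z(w := x)) = outer u v"
      using insert by blast
    have "\<exists>v'. v' \<noteq> (\<lambda>_. 0) \<and> (\<forall>y. \<exists>u. ?B (z' i) y = outer u v')"
    proof (rule common_row_factor_transfer[where e = "d i" and d = "d w" and x = "z i" and v = v])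
      show "linear_fun (d i) (\<lambda>x. ?B x y)" for y
        unfolding fun_upd_twist[OF i(2)] using i by (intro multilinear_imp_linear_fun[OF F]) simp
      show "linear_fun (d w) (?B x)" for x
        by (intro multilinear_imp_linear_fun[OF F]) simp
      show "rank_one (?B x y)" if "nonzero (d i) x" "nonzero (d w) y" for x y
        using that z z' by (intro rk) auto
      show "\<forall>y. \<exists>u. ?B (z i) y = outer u v" using v(2) upd(1) by metis
    qed (use d z z' i v in auto)
    then show ?case unfolding upd(2) .
  qed
  from this[of J] obtain v where v: "v \<noteq> (\<lambda>_. 0)"
      "\<And>x. \<exists>u. F ((\<lambda>i. if i \<in> J then z' i else z i)(w := x)) = outer u v" by blast
  \<comment> \<open>The merged family agrees with \<open>z'\<close> only on \<open>J\<close>, but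
    slot \<open>w\<close> is overwritten and no other slot matters.\<close>
  have "F ((\<lambda>i. if i \<in> J then z' i else z i)(w := x)) = F (z'(w := x))" for x
    by (rule multilinear_local[OF F]) auto
  then show ?thesis using v by metis
qed

text \<open>Induction on the set of variables. The new variable \<open>w\<close> is frozen to apply
  the induction hypothesis, and its type at one base point decides its side. The factor on the other
  side is kept; only the factor that receives \<open>w\<close> is rebuilt.\<close>

theorem multilinear_rank_one_factorization:
  fixes F :: "('i \<Rightarrow> nat \<Rightarrow> 'a::field) \<Rightarrow> 'r \<times> 's \<Rightarrow> 'a"
  assumes "finite I" and "\<And>i. i \<in> I \<Longrightarrow> 2 \<le> d i" and "multilinear I d F"
    and "\<And>z. (\<And>i. i \<in> I \<Longrightarrow> nonzero (d i) (z i)) \<Longrightarrow> rank_one (F z)"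
  shows "\<exists>L f g. L \<subseteq> I \<and> multilinear L d f \<and> multilinear (I - L) d g \<and> (\<forall>z. F z = outer (f z) (g z))"
  using assms
proof (induction I arbitrary: F rule: finite_induct)
  case empty
  obtain u v where uv: "F undefined = outer u v"
    using empty(3)[of undefined] by (auto simp: rank_one_def)
  have "F z = outer u v" for z
    using multilinear_local[OF empty(2), of z undefined] uv by simp
  then show ?case
    by (intro exI[of _ "{}"] exI[of _ "\<lambda>_. u"] exI[of _ "\<lambda>_. v"]) (simp add: multilinear_def)
next
  case (insert w J)
  note F = \<open>multilinear (insert w J) d F\<close>
  let ?e = "unit_fun 0 :: nat \<Rightarrow> 'a"
  have e: "nonzero (d i) ?e" if "i \<in> insert w J" for i
    using insert.prems(1)[OF that] by (auto simp: nonzero_def unit_fun_def)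
  have "multilinear J d (\<lambda>z. F (z(w := ?e)))"
    using multilinear_fix_slot[OF F, of w ?e] insert.hyps(2) by simp
  moreover have "rank_one (F (z(w := ?e)))" if "\<And>i. i \<in> J \<Longrightarrow> nonzero (d i) (z i)" for z
    using that e by (intro insert.prems(3)) auto
  ultimately obtain L f0 g0 where L: "L \<subseteq> J" and f0: "multilinear L d f0"
    and g0: "multilinear (J - L) d g0" and fac: "\<And>z. F (z(w := ?e)) = outer (f0 z) (g0 z)"
    using insert.IH[of "\<lambda>z. F (z(w := ?e))"] insert.prems(1) by auto
  let ?base = "\<lambda>_ :: 'i. ?e"
  have rk0: "rank_one (F (?base(w := x)))" if "nonzero (d w) x" for x
    using that e by (intro insert.prems(3)) auto
  obtain u v where uv: "u \<noteq> (\<lambda>_. 0)" "v \<noteq> (\<lambda>_. 0)" "F (?base(w := ?e)) = outer u v"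
    using rk0[OF e] rank_one_outerE by blast
  have "linear_fun (d w) (\<lambda>x. F (?base(w := x)))"
    by (intro multilinear_imp_linear_fun[OF F]) simp
  from linear_rank_one_cases[OF this rk0 uv(3,1,2)] show ?case
  proof
    assume "\<forall>x. \<exists>u. F (?base(w := x)) = outer u v"
    then have row0: "\<exists>v. v \<noteq> (\<lambda>_. 0) \<and> (\<forall>x. \<exists>u. F (?base(w := x)) = outer u v)" using uv by blast
    have row: "\<exists>v. v \<noteq> (\<lambda>_. 0) \<and> (\<forall>x. \<exists>u. F (z(w := x)) = outer u v)"
      if z: "\<And>i. i \<in> J \<Longrightarrow> nonzero (d i) (z i)" for z
      by (rule common_row_factor_everywhere[OF insert.hyps insert.prems(1) F insert.prems(3) _ z row0])
        (use e in auto)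
    obtain f where f: "multilinear (insert w L) d f" "\<And>z. F z = outer (f z) (g0 z)"
      using factor_last_slot[OF insert.hyps insert.prems(1) F insert.prems(3) L g0 fac row] by blast
    have "insert w J - insert w L = J - L" using insert.hyps by auto
    then show ?case using f g0 L
      by (intro exI[of _ "insert w L"] exI[of _ f] exI[of _ g0]) auto
  next
    assume col: "\<forall>x. \<exists>w'. F (?base(w := x)) = outer u w'"
    \<comment> \<open>Transposition turns a common column factor into a common row factor and
      exchanges \<open>f0\<close> with \<open>g0\<close>, hence \<open>L\<close> with
      \<open>J - L\<close>.\<close>
    define F' where "F' z = (\<lambda>(s, r). F z (r, s))" for z
    have F'_outer: "F z = outer a b \<longleftrightarrow> F' z = outer b a" for z a b
      by (auto simp: F'_def fun_eq_iff mult.commute)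
    have F': "multilinear (insert w J) d F'"
      using F unfolding multilinear_def F'_def by (auto simp: fun_eq_iff)
    have rk': "rank_one (F' z)" if "\<And>i. i \<in> insert w J \<Longrightarrow> nonzero (d i) (z i)" for z
      using insert.prems(3)[OF that] F'_outer unfolding rank_one_def by blast
    have row0: "\<exists>v. v \<noteq> (\<lambda>_. 0) \<and> (\<forall>x. \<exists>u. F' (?base(w := x)) = outer u v)"
      using uv col F'_outer by blast
    have row: "\<exists>v. v \<noteq> (\<lambda>_. 0) \<and> (\<forall>x. \<exists>u. F' (z(w := x)) = outer u v)"
      if z: "\<And>i. i \<in> J \<Longrightarrow> nonzero (d i) (z i)" for z
      by (rule common_row_factor_everywhere[OF insert.hyps insert.prems(1) F' rk' _ z row0])
        (use e in auto)
    have f0': "multilinear (J - (J - L)) d f0" using f0 L by (simp add: double_diff)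
    have fac': "F' (z(w := ?e)) = outer (g0 z) (f0 z)" for z using fac F'_outer by blast
    obtain g where g: "multilinear (insert w (J - L)) d g" "\<And>z. F' z = outer (g z) (f0 z)"
      using factor_last_slot[OF insert.hyps insert.prems(1) F' rk' _ f0' fac' row] by blast
    have "insert w J - L = insert w (J - L)" using insert.hyps L by auto
    then show ?case using g f0 L F'_outer
      by (intro exI[of _ L] exI[of _ f0] exI[of _ g]) auto
  qed
qed

section \<open>Multilinear maps and Kronecker products\<close>

lemma linear_fun_expand:
  assumes "linear_fun d h"
  shows "h x c = (\<Sum>b<d. x b * h (unit_fun b) c)"
proof -
  have "h (\<lambda>t. if t < j then x t else 0) c = (\<Sum>b<j. x b * h (unit_fun b) c)" for j
  proof (induction j)
    case 0
    show ?case using linear_fun_zero[OF assms, of "\<lambda>_. 0"] by (simp add: nonzero_def)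
  next
    case (Suc j)
    have "(\<lambda>t. if t < Suc j then x t else 0) =
        (\<lambda>t. 1 * (if t < j then x t else 0) + x j * unit_fun j t)"
      by (auto simp: unit_fun_def less_Suc_eq)
    then show ?case by (simp only: linear_fun_comb[OF assms] Suc sum.lessThan_Suc) simp
  qed
  from this[of d] show ?thesis
    using linear_fun_local[OF assms, of x "\<lambda>t. if t < d then x t else 0"] by simp
qed

lemma multilinear_expand:
  assumes "multilinear I d f" "i \<in> I"
  shows "f z c = (\<Sum>b<d i. z i b * f (z(i := unit_fun b)) c)"
  using linear_fun_expand[OF multilinear_imp_linear_fun[OF assms], of z "z i" c] by simp

text \<open>The slots in \<open>K\<close> are already free to carry arbitrary vectors, the others
  carry unit vectors. To free slot \<open>i\<close>, both sides are expanded in it.\<close>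

lemma multilinear_eqI:
  fixes f g :: "('i \<Rightarrow> nat \<Rightarrow> 'a::field) \<Rightarrow> 'c \<Rightarrow> 'a"
  assumes "finite I" and f: "multilinear I d f" and g: "multilinear I d g"
    and eq: "\<And>z. (\<And>i. i \<in> I \<Longrightarrow> \<exists>b<d i. z i = unit_fun b) \<Longrightarrow> f z = g z"
  shows "f z = g z"
proof -
  have "\<forall>z. (\<forall>i\<in>I - K. \<exists>b<d i. z i = unit_fun b) \<longrightarrow> f z = g z" if "K \<subseteq> I" for K
    using finite_subset[OF that assms(1)] that
  proof (induction K rule: finite_induct)
    case empty
    then show ?case using eq by blast
  next
    case (insert i K)
    have i: "i \<in> I" using insert.prems by blast
    show ?case
    proof (intro allI impI ext)
      fix z :: "'i \<Rightarrow> nat \<Rightarrow> 'a" and c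
      assume z: "\<forall>j\<in>I - insert i K. \<exists>b<d j. z j = unit_fun b"
      have "f (z(i := unit_fun b)) = g (z(i := unit_fun b))" if "b < d i" for b
      proof -
        have "\<forall>j\<in>I - K. \<exists>b'<d j. (z(i := unit_fun b)) j = unit_fun b'" using that z by auto
        then show ?thesis using insert.IH insert.prems by blast
      qed
      then show "f z c = g z c"
        by (simp add: multilinear_expand[OF f i, of z] multilinear_expand[OF g i, of z])
    qed
  qed
  then show ?thesis by blast
qed

section \<open>Index arithmetic and algebra of the Kronecker product\<close>

lemma sum_lessThan_mult:
  "(\<Sum>t<p * d. f t) = (\<Sum>a<p. \<Sum>b<d. f (a * d + b :: nat))"
proof -
  have "sum f {a * d..<a * d + d} = (\<Sum>b<d. f (a * d + b))" for a
    using sum.shift_bounds_nat_ivl[of f 0 "a * d" d] by (simp add: add.commute lessThan_atLeast0)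
  then show ?thesis by (simp flip: sum.nat_group)
qed

lemma mult_add_less_mult: "a < p \<Longrightarrow> b < d \<Longrightarrow> a * d + b < p * (d :: nat)"
  using mult_le_mono1[of "Suc a" p d] by simp

lemma div_less_of_less_mult: "i < p * d \<Longrightarrow> i div d < (p :: nat)"
  by (simp add: less_mult_imp_div_less)

lemma mod_less_of_less_mult: "i < p * d \<Longrightarrow> i mod d < (d :: nat)"
  by (cases "d = 0") auto

lemma mod_mult_div: "i mod (b * c) div c = i div c mod (b :: nat)"
  by (cases "c = 0") (simp_all add: mod_mult2_eq mult.commute[of b])

lemma mod_mult_mod: "i mod (b * c) mod c = i mod (c :: nat)"
  by (simp add: mod_mod_cancel)

lemma dim_kron [simp]:
  "dim_row (A \<Otimes> B) = dim_row A * dim_row B" "dim_col (A \<Otimes> B) = dim_col A * dim_col B"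
  by (simp_all add: kron_def)

lemma index_kron:
  "i < dim_row A * dim_row B \<Longrightarrow> j < dim_col A * dim_col B \<Longrightarrow>
    (A \<Otimes> B) $$ (i, j) =
      A $$ (i div dim_row B, j div dim_col B) * B $$ (i mod dim_row B, j mod dim_col B)"
  by (simp add: kron_def)

lemma kron_one_right: "A \<Otimes> 1\<^sub>m 1 = (A :: 'a :: semiring_1 mat)"
  by (rule eq_matI) (auto simp: kron_def)

lemma kron_one: "1\<^sub>m p \<Otimes> 1\<^sub>m q = (1\<^sub>m (p * q) :: 'a :: semiring_1 mat)"
proof (rule eq_matI)
  fix i j assume "i < dim_row (1\<^sub>m (p * q))" "j < dim_col (1\<^sub>m (p * q))"
  then have "i < p * q" "j < p * q" by simp_all
  moreover have "i div q = j div q \<and> i mod q = j mod q \<longleftrightarrow> i = j"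
    by (metis div_mult_mod_eq)
  ultimately show "(1\<^sub>m p \<Otimes> 1\<^sub>m q) $$ (i, j) = (1\<^sub>m (p * q) :: 'a mat) $$ (i, j)"
    using div_less_of_less_mult mod_less_of_less_mult by (simp add: index_kron) blast
qed simp_all

lemma kron_assoc: "(A \<Otimes> B) \<Otimes> C = A \<Otimes> (B \<Otimes> (C :: 'a :: semigroup_mult mat))"
proof (rule eq_matI)
  fix i j assume "i < dim_row (A \<Otimes> (B \<Otimes> C))" "j < dim_col (A \<Otimes> (B \<Otimes> C))"
  then have ij: "i < dim_row A * dim_row B * dim_row C" "j < dim_col A * dim_col B * dim_col C"
    by (simp_all add: mult.assoc)
  then have ij': "i < dim_row A * (dim_row B * dim_row C)" "j < dim_col A * (dim_col B * dim_col C)"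
    by (simp_all add: mult.assoc)
  have div: "i div c div b = i div (b * c)" for i b c :: nat
    by (metis div_mult2_eq mult.commute)
  show "((A \<Otimes> B) \<Otimes> C) $$ (i, j) = (A \<Otimes> (B \<Otimes> C)) $$ (i, j)"
    using ij ij' div_less_of_less_mult[OF ij(1)] div_less_of_less_mult[OF ij(2)]
      mod_less_of_less_mult[OF ij'(1)] mod_less_of_less_mult[OF ij'(2)]
    by (simp only: index_kron dim_kron mod_mult_div mod_mult_mod div mult.assoc)
qed (simp_all add: mult.assoc)

text \<open>The mixed product rule: writing the summation index as quotient and remainder by
  \<open>dim_col B\<close> separates the sum into a product of two.\<close>

lemma kron_mult:
  fixes A B C D :: "'a :: comm_ring_1 mat"
  assumes "dim_row C = dim_col A" "dim_row D = dim_col B"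
  shows "(A \<Otimes> B) * (C \<Otimes> D) = (A * C) \<Otimes> (B * D)"
proof (rule eq_matI)
  fix i j assume "i < dim_row ((A * C) \<Otimes> (B * D))" "j < dim_col ((A * C) \<Otimes> (B * D))"
  then have ij: "i < dim_row A * dim_row B" "j < dim_col C * dim_col D" by simp_all
  note less = div_less_of_less_mult[OF ij(1)] div_less_of_less_mult[OF ij(2)]
    mod_less_of_less_mult[OF ij(1)] mod_less_of_less_mult[OF ij(2)]
  let ?a = "\<lambda>t. A $$ (i div dim_row B, t)" and ?b = "\<lambda>t. B $$ (i mod dim_row B, t)"
  let ?c = "\<lambda>t. C $$ (t, j div dim_col D)" and ?d = "\<lambda>t. D $$ (t, j mod dim_col D)"
  have "((A \<Otimes> B) * (C \<Otimes> D)) $$ (i, j)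
      = (\<Sum>t<dim_col A * dim_col B. (A \<Otimes> B) $$ (i, t) * (C \<Otimes> D) $$ (t, j))"
    using ij assms by (simp add: scalar_prod_def lessThan_atLeast0)
  also have "\<dots> = (\<Sum>s<dim_col A. \<Sum>t<dim_col B. (?a s * ?b t) * (?c s * ?d t))"
    unfolding sum_lessThan_mult using ij assms mult_add_less_mult
    by (intro sum.cong refl) (simp add: index_kron)
  also have "\<dots> = (\<Sum>s<dim_col A. ?a s * ?c s) * (\<Sum>t<dim_col B. ?b t * ?d t)"
    unfolding sum_product by (intro sum.cong refl) (simp add: mult_ac)
  also have "\<dots> = ((A * C) \<Otimes> (B * D)) $$ (i, j)"
    using ij less assms by (simp add: index_kron scalar_prod_def lessThan_atLeast0)
  finally show "((A \<Otimes> B) * (C \<Otimes> D)) $$ (i, j) = ((A * C) \<Otimes> (B * D)) $$ (i, j)" .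
qed simp_all

lemma kron_lincomb_left:
  fixes A B C :: "'a :: comm_ring_1 mat"
  assumes "A \<in> carrier_mat r c" "B \<in> carrier_mat r c"
  shows "(a \<cdot>\<^sub>m A + b \<cdot>\<^sub>m B) \<Otimes> C = a \<cdot>\<^sub>m (A \<Otimes> C) + b \<cdot>\<^sub>m (B \<Otimes> C)"
  using assms div_less_of_less_mult
  by (intro eq_matI) (auto simp: index_kron algebra_simps)

lemma kron_lincomb_right:
  fixes A B C :: "'a :: comm_ring_1 mat"
  assumes "A \<in> carrier_mat r c" "B \<in> carrier_mat r c"
  shows "C \<Otimes> (a \<cdot>\<^sub>m A + b \<cdot>\<^sub>m B) = a \<cdot>\<^sub>m (C \<Otimes> A) + b \<cdot>\<^sub>m (C \<Otimes> B)"
  using assms mod_less_of_less_mult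
  by (intro eq_matI) (auto simp: index_kron algebra_simps)

text \<open>Rectangular counterpart of \<open>kron_prod_carrier\<close>, for factors that are
  columns, rows or vectorized matrices.\<close>

lemma kron_prod_carrier_rect:
  assumes "\<And>i. i \<in> {1..k} \<Longrightarrow> A i \<in> carrier_mat (r i) (c i)"
  shows "kron_prod A k \<in> carrier_mat (\<Prod>i = 1..k. r i) (\<Prod>i = 1..k. c i)"
  using assms
proof (induction k)
  case (Suc k)
  have "kron_prod A k \<Otimes> A (Suc k)
      \<in> carrier_mat ((\<Prod>i = 1..k. r i) * r (Suc k)) ((\<Prod>i = 1..k. c i) * c (Suc k))"
    using Suc by (intro kron_carrier) auto
  then show ?case by (simp add: mult.commute)
qed simp

lemma kron_prod_cong:
  "(\<And>i. i \<in> {1..k} \<Longrightarrow> A i = B i) \<Longrightarrow> kron_prod A k = kron_prod B k"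
  by (induction k) auto

lemma kron_prod_mult:
  fixes A B :: "nat \<Rightarrow> 'a :: comm_ring_1 mat"
  assumes "\<And>i. i \<in> {1..k} \<Longrightarrow> A i \<in> carrier_mat (r i) (s i)"
    "\<And>i. i \<in> {1..k} \<Longrightarrow> B i \<in> carrier_mat (s i) (t i)"
  shows "kron_prod A k * kron_prod B k = kron_prod (\<lambda>i. A i * B i) k"
  using assms
proof (induction k)
  case (Suc k)
  have "kron_prod A k \<in> carrier_mat (\<Prod>i = 1..k. r i) (\<Prod>i = 1..k. s i)"
    by (intro kron_prod_carrier_rect) (use Suc.prems in auto)
  moreover have "kron_prod B k \<in> carrier_mat (\<Prod>i = 1..k. s i) (\<Prod>i = 1..k. t i)"
    by (intro kron_prod_carrier_rect) (use Suc.prems in auto)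
  moreover have "A (Suc k) \<in> carrier_mat (r (Suc k)) (s (Suc k))"
    "B (Suc k) \<in> carrier_mat (s (Suc k)) (t (Suc k))" using Suc.prems by auto
  ultimately have "kron_prod A (Suc k) * kron_prod B (Suc k)
      = (kron_prod A k * kron_prod B k) \<Otimes> (A (Suc k) * B (Suc k))"
    unfolding kron_prod.simps by (intro kron_mult) auto
  then show ?case using Suc by simp
qed simp

lemma kron_prod_lincomb:
  fixes A :: "nat \<Rightarrow> 'a :: comm_ring_1 mat"
  assumes "j \<in> {1..k}" "X \<in> carrier_mat (r j) (c j)" "Y \<in> carrier_mat (r j) (c j)"
    and "\<And>i. i \<in> {1..k} \<Longrightarrow> A i \<in> carrier_mat (r i) (c i)"
  shows "kron_prod (A(j := a \<cdot>\<^sub>m X + b \<cdot>\<^sub>m Y)) k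
    = a \<cdot>\<^sub>m kron_prod (A(j := X)) k + b \<cdot>\<^sub>m kron_prod (A(j := Y)) k"
  using assms
proof (induction k)
  case (Suc k)
  show ?case
  proof (cases "j = Suc k")
    case True
    have "kron_prod (A(j := Z)) k = kron_prod A k" for Z
      using True by (intro kron_prod_cong) auto
    then have "kron_prod (A(j := Z)) (Suc k) = kron_prod A k \<Otimes> Z" for Z
      by (simp only: kron_prod.simps fun_upd_same True)
    then show ?thesis by (simp only: kron_lincomb_right[OF Suc.prems(2,3)])
  next
    case False
    have "kron_prod (A(j := Z)) k \<in> carrier_mat (\<Prod>i = 1..k. r i) (\<Prod>i = 1..k. c i)"
      if "Z \<in> carrier_mat (r j) (c j)" for Z
      using that Suc.prems by (intro kron_prod_carrier_rect) auto
    note K = this[OF Suc.prems(2)] this[OF Suc.prems(3)]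
    have "kron_prod (A(j := Z)) (Suc k) = kron_prod (A(j := Z)) k \<Otimes> A (Suc k)" for Z
      using False by simp
    moreover have "kron_prod (A(j := a \<cdot>\<^sub>m X + b \<cdot>\<^sub>m Y)) k
        = a \<cdot>\<^sub>m kron_prod (A(j := X)) k + b \<cdot>\<^sub>m kron_prod (A(j := Y)) k"
      using False Suc.prems by (intro Suc.IH) auto
    ultimately show ?thesis by (simp only: kron_lincomb_left[OF K])
  qed
qed simp

text \<open>The vectors \<open>x_j\<close> and \<open>y_j\<close> will be numbered
  \<open>2 * j - 1\<close> and \<open>2 * j\<close>; this regroups their product by
  \<open>j\<close>.\<close>

lemma kron_prod_double:
  fixes W :: "nat \<Rightarrow> 'a :: semiring_1 mat"
  shows "kron_prod W (2 * k) = kron_prod (\<lambda>j. W (2 * j - 1) \<Otimes> W (2 * j)) k"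
  by (induction k) (simp_all add: kron_assoc)

lemma kron_prod_one:
  "kron_prod (\<lambda>i. 1\<^sub>m (n i)) k = (1\<^sub>m (\<Prod>i = 1..k. n i) :: 'a :: semiring_1 mat)"
  by (induction k) (simp_all add: kron_one mult.commute)

text \<open>The universal property of the tensor product in coordinates. If \<open>Suc k\<close> is
  a variable, expanding it in unit vectors leaves functions multilinear in
  \<open>L - {Suc k}\<close>, to which the induction hypothesis applies.\<close>

lemma multilinear_kron_coeffs:
  fixes f :: "(nat \<Rightarrow> nat \<Rightarrow> 'a::field) \<Rightarrow> 'r \<Rightarrow> 'a"
  assumes "multilinear L d f" "L \<subseteq> {1..k}"
  shows "\<exists>C. \<forall>z r. f z r = (\<Sum>t<(\<Prod>i = 1..k. if i \<in> L then d i else 1).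
      C r t * kron_prod (\<lambda>i. if i \<in> L then mat (d i) 1 (\<lambda>(t, _). z i t) else 1\<^sub>m 1) k $$ (t, 0))"
  using assms
proof (induction k arbitrary: L f)
  case 0
  then have "f z r = f undefined r" for z r
    using multilinear_local[OF 0(1), of z undefined] by simp
  then show ?case by (intro exI[of _ "\<lambda>r _. f undefined r"]) (simp add: lessThan_Suc)
next
  case (Suc k)
  show ?case
  proof (cases "Suc k \<in> L")
    case False
    then have "L \<subseteq> {1..k}" using Suc.prems(2) by (auto simp: le_Suc_eq)
    from Suc.IH[OF Suc.prems(1) this] show ?thesis
      unfolding kron_prod.simps using False by (simp add: kron_one_right[simplified])
  next
    case True
    let ?L = "L - {Suc k}" and ?n = "d (Suc k)"
    let ?K = "\<lambda>L z. kron_prod (\<lambda>i. if i \<in> L then mat (d i) 1 (\<lambda>(t, _). z i t) else 1\<^sub>m 1)"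
    let ?p = "\<Prod>i = 1..k. if i \<in> L then d i else 1"
    have p: "(\<Prod>i = 1..k. if i \<in> ?L then d i else 1) = ?p" by (intro prod.cong) auto
    have K: "?K ?L z k = ?K L z k" for z by (intro kron_prod_cong) auto
    have Kc: "?K L z k \<in> carrier_mat ?p 1" for z
    proof -
      have "?K L z k \<in> carrier_mat ?p (\<Prod>i = 1..k. 1)" by (intro kron_prod_carrier_rect) auto
      then show ?thesis by simp
    qed
    have "\<exists>C. \<forall>z r. f (z(Suc k := unit_fun b)) r = (\<Sum>t<?p. C r t * ?K L z k $$ (t, 0))" for b
    proof -
      have ml: "multilinear ?L d (\<lambda>z. f (z(Suc k := unit_fun b)))"
        by (rule multilinear_fix_slot[OF Suc.prems(1)])
      have "?L \<subseteq> {1..k}" using Suc.prems(2) by (auto simp: le_Suc_eq)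
      from Suc.IH[OF ml this] show ?thesis unfolding p K .
    qed
    then have "\<forall>b. \<exists>C. \<forall>z r. f (z(Suc k := unit_fun b)) r = (\<Sum>t<?p. C r t * ?K L z k $$ (t, 0))"
      by (rule allI)
    from choice[OF this] obtain C where C: "\<And>b z r. f (z(Suc k := unit_fun b)) r = (\<Sum>t<?p. C b r t * ?K L z k $$ (t, 0))"
      by blast
    \<comment> \<open>Position \<open>t = a * ?n + b\<close> of the product carries coordinate
      \<open>b\<close> of the last vector, so the coefficient there is entry \<open>a\<close> of the
      family belonging to the unit vector \<open>b\<close>.\<close>
    have eq: "f z r = (\<Sum>t<?p * ?n. C (t mod ?n) r (t div ?n) * ?K L z (Suc k) $$ (t, 0))" for z r
    proof -
      have entry: "?K L z (Suc k) $$ (a * ?n + b, 0) = ?K L z k $$ (a, 0) * z (Suc k) b"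
        if "a < ?p" "b < ?n" for a b
      proof -
        have "mat ?n 1 (\<lambda>(t, _). z (Suc k) t) \<in> carrier_mat ?n 1" by simp
        from kron_block_entry[OF Kc this that(1) _ that(2), of 0 0 z] show ?thesis
          using that True by simp
      qed
      have "f z r = (\<Sum>b<?n. z (Suc k) b * (\<Sum>a<?p. C b r a * ?K L z k $$ (a, 0)))"
        unfolding multilinear_expand[OF Suc.prems(1) True, of z] C ..
      also have "\<dots> = (\<Sum>b<?n. \<Sum>a<?p. C b r a * (?K L z k $$ (a, 0) * z (Suc k) b))"
        by (simp add: sum_distrib_left mult_ac)
      also have "\<dots> = (\<Sum>a<?p. \<Sum>b<?n. C b r a * (?K L z k $$ (a, 0) * z (Suc k) b))"
        by (rule sum.swap)
      also have "\<dots> = (\<Sum>a<?p. \<Sum>b<?n. C ((a * ?n + b) mod ?n) r ((a * ?n + b) div ?n)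
          * ?K L z (Suc k) $$ (a * ?n + b, 0))"
        by (intro sum.cong refl) (simp add: entry del: kron_prod.simps)
      finally show ?thesis unfolding sum_lessThan_mult .
    qed
    have P: "(\<Prod>i = 1..Suc k. if i \<in> L then d i else 1) = ?p * ?n" using True by simp
    show ?thesis unfolding P
      by (intro exI[of _ "\<lambda>r t. C (t mod ?n) r (t div ?n)"] allI eq)
  qed
qed

section \<open>Rank one and invertible matrices\<close>

text \<open>Extension by zero to all index pairs, so that statements on \<open>rank_one\<close>
  carry no dimensions; \<open>mat_fun_inject\<close> returns to matrices once the shape is
  known.\<close>

definition mat_fun :: "'a::zero mat \<Rightarrow> nat \<times> nat \<Rightarrow> 'a" where
  "mat_fun A = (\<lambda>(i, j). if i < dim_row A \<and> j < dim_col A then A $$ (i, j) else 0)"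

lemma mat_fun_apply:
  "mat_fun A (i, j) = (if i < dim_row A \<and> j < dim_col A then A $$ (i, j) else 0)"
  by (simp add: mat_fun_def)

lemma mat_fun_inject:
  assumes "mat_fun A = mat_fun B" "A \<in> carrier_mat r c" "B \<in> carrier_mat r c"
  shows "A = B"
proof (rule eq_matI)
  fix i j assume "i < dim_row B" "j < dim_col B"
  then show "A $$ (i, j) = B $$ (i, j)"
    using fun_cong[OF assms(1), of "(i, j)"] assms(2,3) by (auto simp: mat_fun_apply)
qed (use assms in auto)

lemma rank_oneI:
  fixes G :: "'r \<times> 's \<Rightarrow> 'a::mult_zero"
  assumes "\<And>r s. G (r, s) = u r * v s" "G (p, q) \<noteq> 0"
  shows "rank_one G"
proof -
  have "G = outer u v" using assms(1) by auto
  moreover have "u p \<noteq> 0" "v q \<noteq> 0" using assms by auto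
  ultimately show ?thesis unfolding rank_one_def by (metis (full_types))
qed

lemma rank_oneE:
  fixes G :: "'r \<times> 's \<Rightarrow> 'a::field"
  assumes "rank_one G"
  obtains u v p q where "\<And>r s. G (r, s) = u r * v s" "u p \<noteq> 0" "v q \<noteq> 0" "G (p, q) \<noteq> 0"
proof -
  obtain u v where uv: "u \<noteq> (\<lambda>_. 0)" "v \<noteq> (\<lambda>_. 0)" "G = outer u v"
    using rank_one_outerE[OF assms] .
  then obtain p q where pq: "u p \<noteq> 0" "v q \<noteq> 0" by (auto simp: fun_eq_iff)
  show thesis by (rule that[of u v p q]) (use uv(3) pq in simp_all)
qed

section \<open>Comparison with the rank of a matrix\<close>

lemma (in vec_space) lin_indpt_singleton:
  assumes "w \<in> carrier_vec n" "w \<noteq> 0\<^sub>v n"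
  shows "lin_indpt {w}"
proof
  assume "lin_dep {w}"
  then obtain a v where "lincomb a {w} = 0\<^sub>v n" "v \<in> {w}" "a v \<noteq> 0"
    using finite_lin_dep[of "{w}"] assms(1) by auto
  then have "a w * w $ i = 0" "a w \<noteq> 0" if "i < n" for i
    using lincomb_index[OF that, of "{w}" a] assms(1) that by auto
  then have "w = 0\<^sub>v n" using assms(1) by (intro eq_vecI) auto
  with assms(2) show False ..
qed

text \<open>A maximal independent set of columns is a singleton \<open>{w}\<close>, so each column
  is a multiple of \<open>w\<close>, and the multipliers form the row factor.\<close>

lemma (in vec_space) rank_one_if_rank_eq_1:
  assumes A: "A \<in> carrier_mat n nc" and "rank A = 1"
  shows "rank_one (mat_fun A)"
proof -
  let ?P = "\<lambda>T. T \<subseteq> set (cols A) \<and> lin_indpt T"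
  have "lin_indpt {}" by (auto simp: lin_dep_def)
  then obtain S where S: "maximal S ?P"
    using maximal_exists_superset[of "set (cols A)" ?P "{}"] by auto
  have "card S = 1" using rank_card_indpt[OF A S] assms(2) by simp
  then obtain w where w: "S = {w}" by (auto simp: card_1_singleton_iff)
  have wP: "w \<in> set (cols A)" "lin_indpt {w}" using S w by (auto simp: maximal_def)
  have cA: "set (cols A) \<subseteq> carrier_vec n" using cols_dim A by blast
  have wc: "w \<in> carrier_vec n" using wP cA by blast
  have w0: "w \<noteq> 0\<^sub>v n" using vs_zero_lin_dep[of "{w}"] wP(2) wc by auto
  have "\<exists>a. \<forall>r<n. c $ r = a * w $ r" if c: "c \<in> set (cols A)" for c
  proof (cases "c = w")
    case True
    then show ?thesis by (intro exI[of _ 1]) simp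
  next
    case False
    have "\<not> lin_indpt ({w} \<union> {c})"
    proof
      assume "lin_indpt ({w} \<union> {c})"
      then have "?P ({w} \<union> {c})" using c wP by auto
      moreover have max: "B = S" if "S \<subseteq> B" "?P B" for B
        using S that by (simp add: maximal_def)
      ultimately have "{w} \<union> {c} = S" by (intro max) (auto simp: w)
      then have "{w} \<union> {c} = {w}" by (simp add: w)
      then show False using False by auto
    qed
    then have "c \<in> span {w}" using lin_dep_iff_in_span[of "{w}" c] wP wc c cA False by auto
    then obtain a where "c = lincomb a {w}" using finite_span[of "{w}"] wc by auto
    then show ?thesis using lincomb_index[of _ "{w}" a] wc by auto
  qed
  then obtain a where a: "\<And>c r. c \<in> set (cols A) \<Longrightarrow> r < n \<Longrightarrow> c $ r = a c * w $ r" by metis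
  define u where "u r = (if r < n then w $ r else 0)" for r
  define v where "v j = (if j < nc then a (col A j) else 0)" for j
  obtain p where p: "p < n" "w $ p \<noteq> 0"
    using w0 wc by (metis eq_vecI carrier_vecD index_zero_vec)
  obtain q where q: "q < nc" "w = col A q"
    using wP(1) A by (metis cols_length cols_nth in_set_conv_nth carrier_matD(2))
  show ?thesis
  proof (rule rank_oneI)
    show "mat_fun A (r, s) = u r * v s" for r s
    proof (cases "r < n \<and> s < nc")
      case True
      then have "col A s \<in> set (cols A)" using A by (auto simp: cols_def)
      from a[OF this, of r] show ?thesis using True A by (simp add: mat_fun_apply u_def v_def)
    next
      case False
      then show ?thesis using A by (auto simp: mat_fun_apply u_def v_def)
    qed
    show "mat_fun A (p, q) \<noteq> 0" using p q A by (simp add: mat_fun_apply)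
  qed
qed

lemma (in vec_space) rank_eq_1_if_rank_one:
  assumes A: "A \<in> carrier_mat n nc" and "rank_one (mat_fun A)"
  shows "rank A = 1"
proof -
  obtain u v p q where uv: "\<And>r s. mat_fun A (r, s) = u r * v s" and pq: "mat_fun A (p, q) \<noteq> 0"
    using rank_oneE[OF assms(2)] by metis
  have "rank A \<le> 1"
  proof (rule rank_le_1_product_entries[OF A])
    show "A $$ (r, c) = u r * v c" if "r < dim_row A" "c < dim_col A" for r c
      using uv[of r c] that by (simp add: mat_fun_apply)
  qed
  moreover have "card {col A q} \<le> rank A"
  proof (rule rank_ge_card_indpt[OF A])
    have pq': "p < n" "q < nc" "A $$ (p, q) \<noteq> 0" using pq A by (auto simp: mat_fun_apply split: if_splits)
    show "{col A q} \<subseteq> set (cols A)" using pq' A by (auto simp: cols_def)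
    have "col A q $ p \<noteq> 0" using pq' A by simp
    then have "col A q \<noteq> 0\<^sub>v n" using pq'(1) by auto
    then show "lin_indpt {col A q}" using A by (intro lin_indpt_singleton) auto
  qed
  ultimately show ?thesis by simp
qed

lemma rank_eq_1_iff_rank_one:
  fixes A :: "'a::field mat"
  assumes "A \<in> carrier_mat r c"
  shows "vec_space.rank r A = 1 \<longleftrightarrow> rank_one (mat_fun A)"
  using vec_space.rank_one_if_rank_eq_1 vec_space.rank_eq_1_if_rank_one assms by blast

lemma index_mult_mat_sum:
  fixes A B :: "'a::semiring_0 mat"
  assumes "A \<in> carrier_mat r n" "B \<in> carrier_mat n c" "i < r" "j < c"
  shows "(A * B) $$ (i, j) = (\<Sum>t<n. A $$ (i, t) * B $$ (t, j))"
  using assms by (simp add: scalar_prod_def lessThan_atLeast0)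

lemma index_kron_block:
  assumes "p < dim_row A" "q < dim_col A" "s < dim_row B" "t < dim_col B"
  shows "(A \<Otimes> B) $$ (p * dim_row B + s, q * dim_col B + t) = A $$ (p, q) * B $$ (s, t)"
  using assms by (intro kron_block_entry) auto

text \<open>A nonzero entry of the product singles out nonzero entries \<open>A $$ (p, q)\<close>
  and \<open>B $$ (s, t)\<close>. Fixing the offset \<open>(s, t)\<close> in every block shows a
  multiple of \<open>A\<close>, the block \<open>(p, q)\<close> is a multiple of \<open>B\<close>,
  and both inherit the outer product form.\<close>

lemma rank_one_kron_iff:
  fixes A B :: "'a::field mat"
  shows "rank_one (mat_fun (A \<Otimes> B)) \<longleftrightarrow> rank_one (mat_fun A) \<and> rank_one (mat_fun B)"
proof
  assume "rank_one (mat_fun (A \<Otimes> B))"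
  then obtain u v i j where uv: "\<And>r s. mat_fun (A \<Otimes> B) (r, s) = u r * v s"
    and ij: "mat_fun (A \<Otimes> B) (i, j) \<noteq> 0"
    using rank_oneE by metis
  let ?rB = "dim_row B" and ?cB = "dim_col B"
  have less: "i < dim_row A * ?rB" "j < dim_col A * ?cB"
    using ij by (auto simp: mat_fun_apply split: if_splits)
  define p q s t where "p = i div ?rB" "q = j div ?cB" "s = i mod ?rB" "t = j mod ?cB"
  have l: "p < dim_row A" "q < dim_col A" "s < ?rB" "t < ?cB"
    unfolding p_q_s_t_def using less div_less_of_less_mult mod_less_of_less_mult by auto
  have ne: "A $$ (p, q) \<noteq> 0" "B $$ (s, t) \<noteq> 0"
    using ij less unfolding p_q_s_t_def by (auto simp: mat_fun_apply index_kron)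
  have prod: "A $$ (p', q') * B $$ (s', t') = u (p' * ?rB + s') * v (q' * ?cB + t')"
    if "p' < dim_row A" "q' < dim_col A" "s' < ?rB" "t' < ?cB" for p' q' s' t'
    using uv[of "p' * ?rB + s'" "q' * ?cB + t'"] index_kron_block[OF that] that
    by (simp add: mat_fun_apply mult_add_less_mult)
  show "rank_one (mat_fun A) \<and> rank_one (mat_fun B)"
  proof
    show "rank_one (mat_fun A)"
    proof (rule rank_oneI)
      show "mat_fun A (p', q') = (if p' < dim_row A then u (p' * ?rB + s) else 0)
          * (if q' < dim_col A then v (q' * ?cB + t) / B $$ (s, t) else 0)" for p' q'
        using prod[of p' q' s t] l ne by (auto simp: mat_fun_apply field_simps)
      show "mat_fun A (p, q) \<noteq> 0" using l ne by (simp add: mat_fun_apply)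
    qed
    show "rank_one (mat_fun B)"
    proof (rule rank_oneI)
      show "mat_fun B (s', t') = (if s' < ?rB then u (p * ?rB + s') else 0)
          * (if t' < ?cB then v (q * ?cB + t') / A $$ (p, q) else 0)" for s' t'
        using prod[of p q s' t'] l ne by (auto simp: mat_fun_apply field_simps)
      show "mat_fun B (s, t) \<noteq> 0" using l ne by (simp add: mat_fun_apply)
    qed
  qed
next
  assume "rank_one (mat_fun A) \<and> rank_one (mat_fun B)"
  then obtain u v p q u' v' s t where A: "\<And>r s. mat_fun A (r, s) = u r * v s" "mat_fun A (p, q) \<noteq> 0"
    and B: "\<And>r s. mat_fun B (r, s) = u' r * v' s" "mat_fun B (s, t) \<noteq> 0"
    using rank_oneE by metis
  let ?rB = "dim_row B" and ?cB = "dim_col B"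
  have l: "p < dim_row A" "q < dim_col A" "s < ?rB" "t < ?cB"
    and ne: "A $$ (p, q) \<noteq> 0" "B $$ (s, t) \<noteq> 0"
    using A(2) B(2) by (auto simp: mat_fun_apply split: if_splits)
  show "rank_one (mat_fun (A \<Otimes> B))"
  proof (rule rank_oneI)
    show "mat_fun (A \<Otimes> B) (i, j) =
        (if i < dim_row A * ?rB then u (i div ?rB) * u' (i mod ?rB) else 0) *
        (if j < dim_col A * ?cB then v (j div ?cB) * v' (j mod ?cB) else 0)" for i j
    proof (cases "i < dim_row A * ?rB \<and> j < dim_col A * ?cB")
      case True
      then have "i div ?rB < dim_row A" "j div ?cB < dim_col A" "i mod ?rB < ?rB" "j mod ?cB < ?cB"
        using div_less_of_less_mult mod_less_of_less_mult by auto
      then show ?thesis using True A(1)[of "i div ?rB" "j div ?cB"] B(1)[of "i mod ?rB" "j mod ?cB"]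
        by (simp add: mat_fun_apply index_kron)
    qed (auto simp: mat_fun_apply)
    show "mat_fun (A \<Otimes> B) (p * ?rB + s, q * ?cB + t) \<noteq> 0"
      using l ne by (simp add: mat_fun_apply index_kron_block mult_add_less_mult)
  qed
qed

lemma rank_one_kron_prod_iff:
  fixes A :: "nat \<Rightarrow> 'a::field mat"
  shows "rank_one (mat_fun (kron_prod A k)) \<longleftrightarrow> (\<forall>j\<in>{1..k}. rank_one (mat_fun (A j)))"
proof (induction k)
  case 0
  have "rank_one (mat_fun (1\<^sub>m 1 :: 'a mat))"
    by (rule rank_oneI[of _ "\<lambda>r. if r < 1 then 1 else 0" "\<lambda>r. if r < 1 then 1 else 0" 0 0])
      (auto simp: mat_fun_apply)
  then show ?case by simp
next
  case (Suc k)
  have "{1..Suc k} = insert (Suc k) {1..k}" by auto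
  then show ?case by (simp add: rank_one_kron_iff Suc conj_commute)
qed

lemma rank_one_transpose:
  fixes A :: "'a::field mat"
  assumes "rank_one (mat_fun A)"
  shows "rank_one (mat_fun (transpose_mat A))"
proof -
  obtain u v p q where uv: "\<And>r s. mat_fun A (r, s) = u r * v s" and pq: "mat_fun A (p, q) \<noteq> 0"
    using rank_oneE[OF assms] by metis
  have t: "mat_fun (transpose_mat A) (s, r) = mat_fun A (r, s)" for r s
    by (auto simp: mat_fun_apply)
  show ?thesis
  proof (rule rank_oneI)
    show "mat_fun (transpose_mat A) (s, r) = v s * u r" for r s by (simp add: t uv)
    show "mat_fun (transpose_mat A) (q, p) \<noteq> 0" using pq by (simp add: t)
  qed
qed

section \<open>Invertible matrices\<close>

lemma invertible_mat_iff_det: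
  fixes A :: "'a::field mat"
  assumes A: "A \<in> carrier_mat n n"
  shows "invertible_mat A \<longleftrightarrow> det A \<noteq> 0"
proof
  assume "invertible_mat A"
  then obtain B where AB: "A * B = 1\<^sub>m n" and BA: "B * A = 1\<^sub>m (dim_row B)"
    using A by (auto simp: invertible_mat_def inverts_mat_def)
  \<comment> \<open>\<open>inverts_mat\<close> leaves the shape of \<open>B\<close> open; comparing
    the numbers of columns in both equations shows that it is square.\<close>
  have "dim_row B = n" using arg_cong[OF BA, of dim_col] A by simp
  moreover have "dim_col B = n" using arg_cong[OF AB, of dim_col] by simp
  ultimately have "B \<in> carrier_mat n n" by blast
  from det_mult[OF A this] show "det A \<noteq> 0" using AB by auto
next
  assume "det A \<noteq> 0"
  from det_non_zero_imp_unit[OF A this, of undefined]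
  obtain B where "B \<in> carrier_mat n n" "B * A = 1\<^sub>m n" "A * B = 1\<^sub>m n"
    unfolding Units_def ring_mat_def by auto
  then show "invertible_mat A"
    using A by (auto simp: invertible_mat_def inverts_mat_def)
qed

text \<open>Padding both factors with zeros to size \<open>m\<close> keeps the product, and the
  padded left factor kills the unit vector with index \<open>s\<close>.\<close>

lemma not_invertible_mult_if_inner_less:
  fixes A B :: "'a::field mat"
  assumes A: "A \<in> carrier_mat m s" and B: "B \<in> carrier_mat s m" and "s < m"
  shows "\<not> invertible_mat (A * B)"
proof -
  let ?A = "mat m m (\<lambda>(i, j). if j < s then A $$ (i, j) else 0)"
  let ?B = "mat m m (\<lambda>(i, j). if i < s then B $$ (i, j) else 0)"
  have "A * B = ?A * ?B"
  proof (rule eq_matI)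
    fix i j assume "i < dim_row (?A * ?B)" "j < dim_col (?A * ?B)"
    then have ij: "i < m" "j < m" by simp_all
    have "(\<Sum>t<s. A $$ (i, t) * B $$ (t, j)) =
        (\<Sum>t<m. (if t < s then A $$ (i, t) else 0) * (if t < s then B $$ (t, j) else 0))"
      using assms(3) by (intro sum.mono_neutral_cong_left) auto
    then show "(A * B) $$ (i, j) = (?A * ?B) $$ (i, j)"
      using ij A B by (simp add: scalar_prod_def lessThan_atLeast0)
  qed (use A B in auto)
  moreover have "det ?A = 0"
  proof -
    have "?A *\<^sub>v unit_vec m s = 0\<^sub>v m"
      using assms(3) by (intro eq_vecI) auto
    moreover have "unit_vec m s \<noteq> (0\<^sub>v m :: 'a vec)"
      using assms(3) by (metis index_unit_vec(1) index_zero_vec(1) zero_neq_one)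
    ultimately show ?thesis
      using det_0_iff_vec_prod_zero_field[of ?A m] unit_vec_carrier[of m s] mat_carrier by blast
  qed
  ultimately have "det (A * B) = 0" using det_mult[of ?A m ?B] by simp
  then show ?thesis using invertible_mat_iff_det[of "A * B" m] A B by auto
qed

text \<open>\<open>M (u v^T) N\<close> is the outer product of \<open>M u\<close> and
  \<open>N^T v\<close>; it is nonzero because \<open>M\<close> and \<open>N\<close> can be
  cancelled.\<close>

lemma rank_one_mult_invertible:
  fixes M X N :: "'a::field mat"
  assumes M: "M \<in> carrier_mat m m" "invertible_mat M" and N: "N \<in> carrier_mat m m" "invertible_mat N"
    and X: "X \<in> carrier_mat m m" "rank_one (mat_fun X)"
  shows "rank_one (mat_fun (M * X * N))"
proof -
  obtain u v p q where uv: "\<And>r s. mat_fun X (r, s) = u r * v s" and pq: "mat_fun X (p, q) \<noteq> 0"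
    using rank_oneE[OF X(2)] by metis
  have inv: "\<exists>B. B \<in> carrier_mat m m \<and> B * A = 1\<^sub>m m \<and> A * B = 1\<^sub>m m"
    if "A \<in> carrier_mat m m" "invertible_mat A" for A :: "'a mat"
    using det_non_zero_imp_unit[OF that(1), of undefined] invertible_mat_iff_det[OF that(1)] that(2)
    unfolding Units_def ring_mat_def by auto
  obtain B where B: "B \<in> carrier_mat m m" "B * M = 1\<^sub>m m" using inv[OF M] by blast
  obtain C where C: "C \<in> carrier_mat m m" "N * C = 1\<^sub>m m" using inv[OF N] by blast
  have "M * X * N \<noteq> 0\<^sub>m m m"
  proof
    assume 0: "M * X * N = 0\<^sub>m m m"
    have "X = (B * M) * X * (N * C)" using B C X by simp
    also have "\<dots> = B * (M * X * N) * C"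
      using B(1) C(1) M(1) N(1) X(1) by (simp add: assoc_mult_mat[of _ m m _ m _ m])
    also have "\<dots> = 0\<^sub>m m m" unfolding 0 using B C by simp
    finally show False using pq by (auto simp: mat_fun_apply split: if_splits)
  qed
  then obtain r s where rs: "r < m" "s < m" "(M * X * N) $$ (r, s) \<noteq> 0"
    using M N by (metis eq_matI index_zero_mat carrier_matD index_mult_mat(2,3))
  have entry: "(M * X * N) $$ (i, j) = (\<Sum>a<m. M $$ (i, a) * u a) * (\<Sum>b<m. v b * N $$ (b, j))"
    if "i < m" "j < m" for i j
  proof -
    have x: "X $$ (a, b) = u a * v b" if "a < m" "b < m" for a b
      using uv[of a b] X that by (simp add: mat_fun_apply)
    have "(M * X * N) $$ (i, j) = (\<Sum>b<m. (\<Sum>a<m. M $$ (i, a) * X $$ (a, b)) * N $$ (b, j))"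
      using that M N X by (simp add: index_mult_mat_sum[of "M * X" m m N m] index_mult_mat_sum[of M m m X m]
          del: index_mult_mat(1) assoc_mult_mat)
    also have "\<dots> = (\<Sum>b<m. (\<Sum>a<m. M $$ (i, a) * u a) * (v b * N $$ (b, j)))"
      by (intro sum.cong refl) (simp add: x sum_distrib_left sum_distrib_right mult_ac)
    finally show ?thesis by (simp add: sum_distrib_left)
  qed
  show ?thesis
  proof (rule rank_oneI)
    show "mat_fun (M * X * N) (i, j) = (if i < m then \<Sum>a<m. M $$ (i, a) * u a else 0)
        * (if j < m then \<Sum>b<m. v b * N $$ (b, j) else 0)" for i j
      using entry[of i j] M N by (auto simp: mat_fun_apply)
    show "mat_fun (M * X * N) (r, s) \<noteq> 0" using rs M N by (simp add: mat_fun_apply)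
  qed
qed

section \<open>Linear maps on Kronecker products\<close>

text \<open>Source and target may have different shapes, so that both \<phi> and the map from a
  product of slots to \<open>M * X * N\<close> are covered.\<close>

definition mat_linear :: "nat \<Rightarrow> nat \<Rightarrow> nat \<Rightarrow> nat \<Rightarrow> ('a::semiring_0 mat \<Rightarrow> 'a mat) \<Rightarrow> bool" where
  "mat_linear r c p q \<Phi> \<longleftrightarrow>
     (\<forall>X \<in> carrier_mat r c. \<Phi> X \<in> carrier_mat p q) \<and>
     (\<forall>X \<in> carrier_mat r c. \<forall>Y \<in> carrier_mat r c. \<forall>a b.
        \<Phi> (a \<cdot>\<^sub>m X + b \<cdot>\<^sub>m Y) = a \<cdot>\<^sub>m \<Phi> X + b \<cdot>\<^sub>m \<Phi> Y)"

lemma mat_linear_if_linear_map: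
  assumes "linear_map class_ring (module_mat TYPE('a :: field) r c) (module_mat TYPE('a) p q) \<Phi>"
  shows "mat_linear r c p q \<Phi>"
  using assms unfolding linear_map_mat_iff mat_linear_def by simp

lemma mat_linear_mult:
  fixes M N :: "'a::comm_ring_1 mat"
  assumes M: "M \<in> carrier_mat p r" and N: "N \<in> carrier_mat c q"
  shows "mat_linear r c p q (\<lambda>X. M * X * N)"
  unfolding mat_linear_def
proof (intro conjI ballI allI)
  show "M * X * N \<in> carrier_mat p q" if "X \<in> carrier_mat r c" for X
    using assms that by simp
  fix X Y :: "'a mat" and a b assume X: "X \<in> carrier_mat r c" and Y: "Y \<in> carrier_mat r c"
  have "M * (a \<cdot>\<^sub>m X + b \<cdot>\<^sub>m Y) = a \<cdot>\<^sub>m (M * X) + b \<cdot>\<^sub>m (M * Y)"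
    using M X Y by (simp add: mult_add_distrib_mat[of M p r _ c] mult_smult_distrib[of M p r _ c])
  moreover have "(a \<cdot>\<^sub>m (M * X) + b \<cdot>\<^sub>m (M * Y)) * N = a \<cdot>\<^sub>m (M * X * N) + b \<cdot>\<^sub>m (M * Y * N)"
    using M N X Y
    by (simp add: add_mult_distrib_mat[of _ p c _ N q] mult_smult_assoc_mat[of _ p c N q])
  ultimately show "M * (a \<cdot>\<^sub>m X + b \<cdot>\<^sub>m Y) * N = a \<cdot>\<^sub>m (M * X * N) + b \<cdot>\<^sub>m (M * Y * N)" by simp
qed

lemma mat_fun_lincomb:
  fixes X Y :: "'a::comm_ring_1 mat"
  assumes "X \<in> carrier_mat r c" "Y \<in> carrier_mat r c"
  shows "mat_fun (a \<cdot>\<^sub>m X + b \<cdot>\<^sub>m Y) s = a * mat_fun X s + b * mat_fun Y s"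
  using assms by (cases s) (auto simp: mat_fun_apply)

lemma mat_linear_kron_prod_lincomb:
  fixes A :: "nat \<Rightarrow> 'a :: comm_ring_1 mat"
  assumes \<Phi>: "mat_linear (\<Prod>i = 1..k. r i) (\<Prod>i = 1..k. c i) p q \<Phi>" and j: "j \<in> {1..k}"
    and X: "X \<in> carrier_mat (r j) (c j)" and Y: "Y \<in> carrier_mat (r j) (c j)"
    and A: "\<And>i. i \<in> {1..k} \<Longrightarrow> A i \<in> carrier_mat (r i) (c i)"
  shows "mat_fun (\<Phi> (kron_prod (A(j := a \<cdot>\<^sub>m X + b \<cdot>\<^sub>m Y)) k)) s
    = a * mat_fun (\<Phi> (kron_prod (A(j := X)) k)) s + b * mat_fun (\<Phi> (kron_prod (A(j := Y)) k)) s"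
proof -
  have K: "kron_prod (A(j := Z)) k \<in> carrier_mat (\<Prod>i = 1..k. r i) (\<Prod>i = 1..k. c i)"
    if "Z \<in> carrier_mat (r j) (c j)" for Z
    using that A by (intro kron_prod_carrier_rect) auto
  have "kron_prod (A(j := a \<cdot>\<^sub>m X + b \<cdot>\<^sub>m Y)) k
      = a \<cdot>\<^sub>m kron_prod (A(j := X)) k + b \<cdot>\<^sub>m kron_prod (A(j := Y)) k"
    by (rule kron_prod_lincomb[where r = r and c = c]) (use j X Y A in auto)
  then show ?thesis
    using \<Phi> K[OF X] K[OF Y] unfolding mat_linear_def by (simp add: mat_fun_lincomb[of _ p q])
qed

text \<open>\<open>B j\<close> builds the factor \<open>j\<close> linearly from a coordinate vector.
  This makes maps on Kronecker products comparable by \<open>multilinear_eqI\<close>.\<close>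

lemma multilinear_kron_prod:
  fixes B :: "nat \<Rightarrow> (nat \<Rightarrow> 'a) \<Rightarrow> 'a::field mat"
  assumes \<Phi>: "mat_linear (\<Prod>i = 1..k. r i) (\<Prod>i = 1..k. c i) p q \<Phi>"
    and B: "\<And>j x. j \<in> {1..k} \<Longrightarrow> B j x \<in> carrier_mat (r j) (c j)"
    and local: "\<And>j x y. j \<in> {1..k} \<Longrightarrow> (\<And>t. t < d j \<Longrightarrow> x t = y t) \<Longrightarrow> B j x = B j y"
    and comb: "\<And>j x y a b. j \<in> {1..k} \<Longrightarrow> B j (\<lambda>t. a * x t + b * y t) = a \<cdot>\<^sub>m B j x + b \<cdot>\<^sub>m B j y"
  shows "multilinear {1..k} d (\<lambda>w. mat_fun (\<Phi> (kron_prod (\<lambda>j. B j (w j)) k)))"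
  unfolding multilinear_def
proof (intro conjI allI impI ballI)
  fix z z' :: "nat \<Rightarrow> nat \<Rightarrow> 'a" assume "\<forall>i\<in>{1..k}. \<forall>t<d i. z i t = z' i t"
  then have "kron_prod (\<lambda>j. B j (z j)) k = kron_prod (\<lambda>j. B j (z' j)) k"
    by (intro kron_prod_cong local) auto
  then show "mat_fun (\<Phi> (kron_prod (\<lambda>j. B j (z j)) k)) = mat_fun (\<Phi> (kron_prod (\<lambda>j. B j (z' j)) k))"
    by simp
next
  fix i z x y a b s assume i: "i \<in> {1..k}"
  have upd: "(\<lambda>j. B j ((z(i := x)) j)) = (\<lambda>j. B j (z j))(i := B i x)" for x by auto
  show "mat_fun (\<Phi> (kron_prod (\<lambda>j. B j ((z(i := \<lambda>t. a * x t + b * y t)) j)) k)) s =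
      a * mat_fun (\<Phi> (kron_prod (\<lambda>j. B j ((z(i := x)) j)) k)) s +
      b * mat_fun (\<Phi> (kron_prod (\<lambda>j. B j ((z(i := y)) j)) k)) s"
    unfolding upd comb[OF i] by (rule mat_linear_kron_prod_lincomb[OF \<Phi> i B[OF i] B[OF i] B])
qed

lemma kron_prod_transpose:
  "transpose_mat (kron_prod A k) = kron_prod (\<lambda>i. transpose_mat (A i)) k"
proof (induction k)
  case (Suc k)
  have "transpose_mat (B \<Otimes> C) = transpose_mat B \<Otimes> transpose_mat C" for B C :: "'a mat"
    using div_less_of_less_mult mod_less_of_less_mult
    by (intro eq_matI) (auto simp: index_kron)
  then show ?case using Suc by simp
qed simp

section \<open>Matrices assembled from two vectors\<close>

definition col_mat :: "nat \<Rightarrow> (nat \<Rightarrow> 'a) \<Rightarrow> 'a mat" where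
  "col_mat d x = mat d 1 (\<lambda>(t, _). x t)"

definition outer_mat :: "nat \<Rightarrow> (nat \<Rightarrow> 'a) \<Rightarrow> (nat \<Rightarrow> 'a) \<Rightarrow> 'a :: times mat" where
  "outer_mat n x y = mat n n (\<lambda>(a, b). x a * y b)"

text \<open>Entries are read row by row, so that \<open>x y^T\<close> becomes the Kronecker product
  of the columns \<open>x\<close> and \<open>y\<close>.\<close>

definition vectorize :: "'a mat \<Rightarrow> 'a mat" where
  "vectorize A = mat (dim_row A * dim_col A) 1 (\<lambda>(i, _). A $$ (i div dim_col A, i mod dim_col A))"

text \<open>For \<open>A = x y\<^sup>T\<close>, \<open>p\<close> and \<open>q\<close> tell whether \<open>x\<close> and \<open>y\<close> enter the left factor \<open>f\<close>.\<close>

definition slot :: "bool \<Rightarrow> bool \<Rightarrow> 'a mat \<Rightarrow> 'a mat" where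
  "slot p q A =
     (if p then if q then vectorize A else A
      else if q then transpose_mat A else transpose_mat (vectorize A))"

definition slot_dim :: "bool \<Rightarrow> bool \<Rightarrow> nat \<Rightarrow> nat" where
  "slot_dim p q n = (if p then n else 1) * (if q then n else 1)"

lemma slot_carrier:
  "A \<in> carrier_mat n n \<Longrightarrow> slot p q A \<in> carrier_mat (slot_dim p q n) (slot_dim (\<not> p) (\<not> q) n)"
  by (auto simp: slot_def slot_dim_def vectorize_def)

lemma slot_lincomb:
  fixes A B :: "'a::comm_ring_1 mat"
  assumes "A \<in> carrier_mat n n" "B \<in> carrier_mat n n"
  shows "slot p q (a \<cdot>\<^sub>m A + b \<cdot>\<^sub>m B) = a \<cdot>\<^sub>m slot p q A + b \<cdot>\<^sub>m slot p q B"
  using assms div_less_of_less_mult[of _ n n] mod_less_of_less_mult[of _ n n]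
  by (intro eq_matI) (auto simp: slot_def vectorize_def)

text \<open>The origin of the identity and the transposition: a column \<open>x\<close> with a row
  \<open>y\<close> gives \<open>x y^T\<close>, a row \<open>x\<close> with a column \<open>y\<close>
  gives \<open>y x^T\<close>. Two columns or two rows give a vectorization.\<close>

lemma kron_slot:
  fixes x y :: "nat \<Rightarrow> 'a::comm_semiring_1"
  shows "(if p then col_mat n x else transpose_mat (col_mat n x)) \<Otimes>
     (if q then col_mat n y else transpose_mat (col_mat n y)) = slot p q (outer_mat n x y)"
  using div_less_of_less_mult[of _ n n] mod_less_of_less_mult[of _ n n]
  by (intro eq_matI) (auto simp: slot_def vectorize_def col_mat_def outer_mat_def index_kron mult.commute)

lemma double_div_two:
  assumes "j \<in> {1..k}"
  shows "(2 * j - 1 + 1) div 2 = j" "(2 * j + 1) div 2 = (j :: nat)"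
  using assms by auto

lemma prod_double:
  fixes f :: "nat \<Rightarrow> 'a::comm_monoid_mult"
  shows "(\<Prod>i = 1..2 * k. f i) = (\<Prod>j = 1..k. f (2 * j - 1) * f (2 * j))"
  by (induction k) (simp_all add: mult.assoc)

lemma outer_mat_carrier: "outer_mat n x y \<in> carrier_mat n n"
  by (simp add: outer_mat_def)

lemma outer_mat_lincomb:
  fixes x y z :: "nat \<Rightarrow> 'a::comm_ring_1"
  shows "outer_mat n (\<lambda>t. a * x t + b * y t) z = a \<cdot>\<^sub>m outer_mat n x z + b \<cdot>\<^sub>m outer_mat n y z"
    and "outer_mat n z (\<lambda>t. a * x t + b * y t) = a \<cdot>\<^sub>m outer_mat n z x + b \<cdot>\<^sub>m outer_mat n z y"
  by (auto simp: outer_mat_def algebra_simps intro!: eq_matI)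

lemma outer_mat_cong:
  "(\<And>t. t < n \<Longrightarrow> x t = x' t) \<Longrightarrow> (\<And>t. t < n \<Longrightarrow> y t = y' t) \<Longrightarrow> outer_mat n x y = outer_mat n x' y'"
  by (auto simp: outer_mat_def intro!: eq_matI)

text \<open>Variable \<open>i\<close> belongs to the factor \<open>(i + 1) div 2\<close> and enters
  it linearly, as its column vector if \<open>i\<close> is odd and as its row vector if
  \<open>i\<close> is even.\<close>

lemma multilinear_kron_prod_outer_mat:
  fixes \<phi> :: "'a::field mat \<Rightarrow> 'a mat"
  assumes \<phi>: "mat_linear (\<Prod>i = 1..k. n i) (\<Prod>i = 1..k. n i) p q \<phi>"
  shows "multilinear {1..2 * k} (\<lambda>i. n ((i + 1) div 2))
    (\<lambda>z. mat_fun (\<phi> (kron_prod (\<lambda>j. outer_mat (n j) (z (2 * j - 1)) (z (2 * j))) k)))"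
    (is "multilinear _ ?d (\<lambda>z. mat_fun (\<phi> (kron_prod (?E z) k)))")
  unfolding multilinear_def
proof (intro conjI allI impI ballI)
  fix z z' :: "nat \<Rightarrow> nat \<Rightarrow> 'a" assume eq: "\<forall>i\<in>{1..2 * k}. \<forall>t<?d i. z i t = z' i t"
  have "?E z j = ?E z' j" if j: "j \<in> {1..k}" for j
  proof (rule outer_mat_cong)
    have m: "2 * j - 1 \<in> {1..2 * k}" "2 * j \<in> {1..2 * k}" using j by auto
    note eq[rule_format, OF m(1)] eq[rule_format, OF m(2)]
    then show "t < n j \<Longrightarrow> z (2 * j - 1) t = z' (2 * j - 1) t" "t < n j \<Longrightarrow> z (2 * j) t = z' (2 * j) t" for t
      unfolding double_div_two[OF j] by simp_all
  qed
  then have "kron_prod (?E z) k = kron_prod (?E z') k" by (rule kron_prod_cong)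
  then show "mat_fun (\<phi> (kron_prod (?E z) k)) = mat_fun (\<phi> (kron_prod (?E z') k))" by simp
next
  fix i and z :: "nat \<Rightarrow> nat \<Rightarrow> 'a" and x y a b s
  assume i: "i \<in> {1..2 * k}"
  define j where "j = (i + 1) div 2"
  have j: "j \<in> {1..k}" "i = 2 * j - 1 \<or> i = 2 * j" using i by (auto simp: j_def)
  define B where "B x = (if i = 2 * j then outer_mat (n j) (z (2 * j - 1)) x
      else outer_mat (n j) x (z (2 * j)))" for x
  have upd: "?E (z(i := x)) = (?E z)(j := B x)" for x
  proof
    fix j'
    show "?E (z(i := x)) j' = ((?E z)(j := B x)) j'"
    proof (cases "j' = j")
      case True
      then show ?thesis using j by (auto simp: B_def)
    next
      case False
      then have "i \<noteq> 2 * j' - 1" "i \<noteq> 2 * j'" using i by (auto simp: j_def)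
      then show ?thesis using False by simp
    qed
  qed
  have B: "B x \<in> carrier_mat (n j) (n j)" for x by (simp add: B_def outer_mat_carrier)
  have comb: "B (\<lambda>t. a * x t + b * y t) = a \<cdot>\<^sub>m B x + b \<cdot>\<^sub>m B y"
    by (simp add: B_def outer_mat_lincomb)
  show "mat_fun (\<phi> (kron_prod (?E (z(i := \<lambda>t. a * x t + b * y t))) k)) s =
      a * mat_fun (\<phi> (kron_prod (?E (z(i := x))) k)) s + b * mat_fun (\<phi> (kron_prod (?E (z(i := y))) k)) s"
    unfolding upd comb
    by (rule mat_linear_kron_prod_lincomb[OF \<phi> j(1) B B outer_mat_carrier])
qed

lemma multilinear_kron_mat:
  fixes f :: "(nat \<Rightarrow> nat \<Rightarrow> 'a::field) \<Rightarrow> nat \<Rightarrow> 'a"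
  assumes "multilinear L d f" "L \<subseteq> {1..k}"
  obtains M where "M \<in> carrier_mat p (\<Prod>i = 1..k. if i \<in> L then d i else 1)"
    "\<And>z r. r < p \<Longrightarrow> f z r = (M * kron_prod (\<lambda>i. if i \<in> L then col_mat (d i) (z i) else 1\<^sub>m 1) k) $$ (r, 0)"
proof -
  let ?R = "\<Prod>i = 1..k. if i \<in> L then d i else 1"
  let ?U = "\<lambda>z i. if i \<in> L then col_mat (d i) (z i) else 1\<^sub>m 1"
  obtain C where C: "\<And>z r. f z r = (\<Sum>t<?R. C r t * kron_prod (?U z) k $$ (t, 0))"
    using multilinear_kron_coeffs[OF assms] unfolding col_mat_def by blast
  have U: "kron_prod (?U z) k \<in> carrier_mat ?R (\<Prod>i = 1..k. 1)" for z
    by (intro kron_prod_carrier_rect) (auto simp: col_mat_def)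
  show thesis
  proof (rule that)
    show "mat p ?R (\<lambda>(r, t). C r t) \<in> carrier_mat p ?R" by simp
    show "f z r = (mat p ?R (\<lambda>(r, t). C r t) * kron_prod (?U z) k) $$ (r, 0)" if "r < p" for z r
      unfolding C using that U[of z] by (simp add: index_mult_mat_sum[of _ p ?R _ 1] del: index_mult_mat(1))
  qed
qed

lemma kron_prod_outer_mat_factorization:
  fixes \<phi> :: "'a::field mat \<Rightarrow> 'a mat"
  assumes n: "\<And>i. i \<in> {1..k} \<Longrightarrow> 2 \<le> n i"
    and \<phi>: "mat_linear (\<Prod>i = 1..k. n i) (\<Prod>i = 1..k. n i) p q \<phi>"
    and rk: "\<And>x y. (\<And>j. j \<in> {1..k} \<Longrightarrow> nonzero (n j) (x j) \<and> nonzero (n j) (y j)) \<Longrightarrow>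
      rank_one (mat_fun (\<phi> (kron_prod (\<lambda>j. outer_mat (n j) (x j) (y j)) k)))"
  shows "\<exists>M N P Q. M \<in> carrier_mat p (\<Prod>j = 1..k. slot_dim (P j) (Q j) (n j)) \<and>
    N \<in> carrier_mat (\<Prod>j = 1..k. slot_dim (\<not> P j) (\<not> Q j) (n j)) q \<and>
    (\<forall>x y. \<phi> (kron_prod (\<lambda>j. outer_mat (n j) (x j) (y j)) k) =
      M * kron_prod (\<lambda>j. slot (P j) (Q j) (outer_mat (n j) (x j) (y j))) k * N)"
proof -
  let ?I = "{1..2 * k}" and ?d = "\<lambda>i. n ((i + 1) div 2)"
  let ?E = "\<lambda>z j. outer_mat (n j) (z (2 * j - 1)) (z (2 * j))"
  let ?F = "\<lambda>z. mat_fun (\<phi> (kron_prod (?E z) k))"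
  have E: "kron_prod (?E z) k \<in> carrier_mat (\<Prod>i = 1..k. n i) (\<Prod>i = 1..k. n i)" for z
    by (intro kron_prod_carrier_rect outer_mat_carrier)
  have \<phi>E: "\<phi> (kron_prod (?E z) k) \<in> carrier_mat p q" for z
    using \<phi> E by (auto simp: mat_linear_def)
  have d2: "2 \<le> ?d i" if "i \<in> ?I" for i using that by (intro n) auto
  have rkF: "rank_one (?F z)" if z: "\<And>i. i \<in> ?I \<Longrightarrow> nonzero (?d i) (z i)" for z
  proof (rule rk)
    fix j assume j: "j \<in> {1..k}"
    then have "2 * j - 1 \<in> ?I" "2 * j \<in> ?I" by auto
    from z[OF this(1)] z[OF this(2)] show "nonzero (n j) (z (2 * j - 1)) \<and> nonzero (n j) (z (2 * j))"
      unfolding double_div_two[OF j] by simp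
  qed
  obtain L f g where L: "L \<subseteq> ?I" and f: "multilinear L ?d f" and g: "multilinear (?I - L) ?d g"
    and F: "\<And>z. ?F z = outer (f z) (g z)"
    using multilinear_rank_one_factorization[OF _ d2 multilinear_kron_prod_outer_mat[OF \<phi>] rkF] by auto
  let ?R = "\<Prod>i = 1..2 * k. if i \<in> L then ?d i else 1"
  let ?C = "\<Prod>i = 1..2 * k. if i \<in> ?I - L then ?d i else 1"
  let ?U = "\<lambda>z i. if i \<in> L then col_mat (?d i) (z i) else 1\<^sub>m 1"
  let ?V = "\<lambda>z i. if i \<in> ?I - L then col_mat (?d i) (z i) else 1\<^sub>m 1"
  obtain M where M: "M \<in> carrier_mat p ?R"
    and fM: "\<And>z r. r < p \<Longrightarrow> f z r = (M * kron_prod (?U z) (2 * k)) $$ (r, 0)"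
    by (rule multilinear_kron_mat[OF f L, of p]) blast
  obtain N where N: "N \<in> carrier_mat q ?C"
    and gN: "\<And>z r. r < q \<Longrightarrow> g z r = (N * kron_prod (?V z) (2 * k)) $$ (r, 0)"
    by (rule multilinear_kron_mat[OF g Diff_subset, of q]) blast
  define P where "P j \<longleftrightarrow> 2 * j - 1 \<in> L" for j
  define Q where "Q j \<longleftrightarrow> 2 * j \<in> L" for j
  have R: "?R = (\<Prod>j = 1..k. slot_dim (P j) (Q j) (n j))"
    unfolding prod_double
  proof (rule prod.cong)
    fix j assume j: "j \<in> {1..k}"
    show "(if 2 * j - 1 \<in> L then ?d (2 * j - 1) else 1) * (if 2 * j \<in> L then ?d (2 * j) else 1)
        = slot_dim (P j) (Q j) (n j)"
      unfolding double_div_two[OF j] by (simp add: slot_dim_def P_def Q_def)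
  qed simp
  have C: "?C = (\<Prod>j = 1..k. slot_dim (\<not> P j) (\<not> Q j) (n j))"
    unfolding prod_double
  proof (rule prod.cong)
    fix j assume j: "j \<in> {1..k}"
    then have "2 * j - 1 \<in> ?I" "2 * j \<in> ?I" by auto
    then show "(if 2 * j - 1 \<in> ?I - L then ?d (2 * j - 1) else 1) *
        (if 2 * j \<in> ?I - L then ?d (2 * j) else 1) = slot_dim (\<not> P j) (\<not> Q j) (n j)"
      unfolding double_div_two[OF j] by (simp add: slot_dim_def P_def Q_def)
  qed simp
  let ?W = "\<lambda>z i. if i \<in> L then col_mat (?d i) (z i) else transpose_mat (col_mat (?d i) (z i))"
  have main: "\<phi> (kron_prod (?E z) k) = M * kron_prod (\<lambda>j. slot (P j) (Q j) (?E z j)) k * transpose_mat N" for z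
  proof -
    let ?KU = "kron_prod (?U z) (2 * k)" and ?KV = "kron_prod (?V z) (2 * k)"
    have "?KU \<in> carrier_mat ?R (\<Prod>i = 1..2 * k. 1)"
      by (intro kron_prod_carrier_rect) (auto simp: col_mat_def)
    then have KU: "?KU \<in> carrier_mat ?R 1" by simp
    have "?KV \<in> carrier_mat ?C (\<Prod>i = 1..2 * k. 1)"
      by (intro kron_prod_carrier_rect) (auto simp: col_mat_def)
    then have KV: "?KV \<in> carrier_mat ?C 1" by simp
    have KVt: "transpose_mat ?KV \<in> carrier_mat 1 ?C" using KV by simp
    have Nt: "transpose_mat N \<in> carrier_mat ?C q" using N by simp
    have "?KU * transpose_mat ?KV = kron_prod (\<lambda>i. ?U z i * transpose_mat (?V z i)) (2 * k)"
      unfolding kron_prod_transpose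
      by (rule kron_prod_mult[where r = "\<lambda>i. if i \<in> L then ?d i else 1" and s = "\<lambda>_. 1"
            and t = "\<lambda>i. if i \<in> ?I - L then ?d i else 1"]) (auto simp: col_mat_def)
    \<comment> \<open>For each \<open>i\<close> exactly one of the two factors is the 1 by 1
      placeholder, so a single column or row remains.\<close>
    also have "\<dots> = kron_prod (?W z) (2 * k)"
    proof (rule kron_prod_cong)
      fix i assume "i \<in> ?I"
      moreover have "col_mat (?d i) (z i) \<in> carrier_mat (?d i) 1" by (simp add: col_mat_def)
      ultimately show "?U z i * transpose_mat (?V z i) = ?W z i" by auto
    qed
    also have "\<dots> = kron_prod (\<lambda>j. slot (P j) (Q j) (?E z j)) k"
      unfolding kron_prod_double
    proof (rule kron_prod_cong)
      fix j assume j: "j \<in> {1..k}"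
      show "?W z (2 * j - 1) \<Otimes> ?W z (2 * j) = slot (P j) (Q j) (?E z j)"
        unfolding double_div_two[OF j] P_def Q_def by (rule kron_slot)
    qed
    finally have K: "kron_prod (\<lambda>j. slot (P j) (Q j) (?E z j)) k = ?KU * transpose_mat ?KV" ..
    \<comment> \<open>Regrouped as \<open>(M u) (N v)^T\<close>, the product is \<open>f g^T\<close>
      entry by entry.\<close>
    have "M * (?KU * transpose_mat ?KV) * transpose_mat N = (M * ?KU) * (transpose_mat ?KV * transpose_mat N)"
      unfolding assoc_mult_mat[OF M KU KVt, symmetric]
      by (rule assoc_mult_mat[OF mult_carrier_mat[OF M KU] KVt Nt])
    also have "transpose_mat ?KV * transpose_mat N = transpose_mat (N * ?KV)"
      using transpose_mult[OF N KV] by simp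
    also have "(M * ?KU) * transpose_mat (N * ?KV) = \<phi> (kron_prod (?E z) k)"
    proof (rule eq_matI)
      fix r c assume "r < dim_row (\<phi> (kron_prod (?E z) k))" "c < dim_col (\<phi> (kron_prod (?E z) k))"
      then have rc: "r < p" "c < q" using \<phi>E[of z] by auto
      have "((M * ?KU) * transpose_mat (N * ?KV)) $$ (r, c) = (M * ?KU) $$ (r, 0) * (N * ?KV) $$ (c, 0)"
        using M N KU KV rc
        by (subst index_mult_mat_sum[of _ p 1 _ q]) (simp_all add: lessThan_Suc del: index_mult_mat(1))
      also have "\<dots> = ?F z (r, c)" unfolding F using fM gN rc by simp
      also have "\<dots> = \<phi> (kron_prod (?E z) k) $$ (r, c)" using rc \<phi>E[of z] by (simp add: mat_fun_apply)
      finally show "((M * ?KU) * transpose_mat (N * ?KV)) $$ (r, c) = \<phi> (kron_prod (?E z) k) $$ (r, c)" .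
    qed (use M N \<phi>E[of z] in auto)
    finally show ?thesis unfolding K ..
  qed
  show ?thesis
  proof (intro exI conjI allI)
    show "M \<in> carrier_mat p (\<Prod>j = 1..k. slot_dim (P j) (Q j) (n j))" using M unfolding R .
    show "transpose_mat N \<in> carrier_mat (\<Prod>j = 1..k. slot_dim (\<not> P j) (\<not> Q j) (n j)) q"
      using N unfolding C by simp
    fix x y :: "nat \<Rightarrow> nat \<Rightarrow> 'a"
    define z where "z i = (if even i then y (i div 2) else x ((i + 1) div 2))" for i
    have Ez: "?E z j = outer_mat (n j) (x j) (y j)" if "j \<in> {1..k}" for j
    proof -
      have "odd (2 * j - 1)" using that by auto
      then show ?thesis unfolding z_def double_div_two(1)[OF that] by simp
    qed
    have "kron_prod (?E z) k = kron_prod (\<lambda>j. outer_mat (n j) (x j) (y j)) k"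
      by (rule kron_prod_cong) (rule Ez)
    moreover have "kron_prod (\<lambda>j. slot (P j) (Q j) (?E z j)) k
        = kron_prod (\<lambda>j. slot (P j) (Q j) (outer_mat (n j) (x j) (y j))) k"
      by (rule kron_prod_cong) (simp only: Ez)
    ultimately show "\<phi> (kron_prod (\<lambda>j. outer_mat (n j) (x j) (y j)) k) =
        M * kron_prod (\<lambda>j. slot (P j) (Q j) (outer_mat (n j) (x j) (y j))) k * transpose_mat N"
      using main[of z] by simp
  qed
qed

text \<open>Both sides are multilinear in the matrices \<open>A j\<close>, so they need to agree
  only on matrix units, which are outer products of unit vectors.\<close>

lemma kron_prod_factorization:
  fixes \<phi> :: "'a::field mat \<Rightarrow> 'a mat"
  assumes n: "\<And>i. i \<in> {1..k} \<Longrightarrow> 2 \<le> n i"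
    and \<phi>: "mat_linear (\<Prod>i = 1..k. n i) (\<Prod>i = 1..k. n i) p q \<phi>"
    and rk: "\<And>x y. (\<And>j. j \<in> {1..k} \<Longrightarrow> nonzero (n j) (x j) \<and> nonzero (n j) (y j)) \<Longrightarrow>
      rank_one (mat_fun (\<phi> (kron_prod (\<lambda>j. outer_mat (n j) (x j) (y j)) k)))"
  shows "\<exists>M N P Q. M \<in> carrier_mat p (\<Prod>j = 1..k. slot_dim (P j) (Q j) (n j)) \<and>
    N \<in> carrier_mat (\<Prod>j = 1..k. slot_dim (\<not> P j) (\<not> Q j) (n j)) q \<and>
    (\<forall>A. (\<forall>j\<in>{1..k}. A j \<in> carrier_mat (n j) (n j)) \<longrightarrow>
      \<phi> (kron_prod A k) = M * kron_prod (\<lambda>j. slot (P j) (Q j) (A j)) k * N)"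
proof -
  obtain M P Q N where M: "M \<in> carrier_mat p (\<Prod>j = 1..k. slot_dim (P j) (Q j) (n j))"
    and N: "N \<in> carrier_mat (\<Prod>j = 1..k. slot_dim (\<not> P j) (\<not> Q j) (n j)) q"
    and outer: "\<And>x y. \<phi> (kron_prod (\<lambda>j. outer_mat (n j) (x j) (y j)) k) =
      M * kron_prod (\<lambda>j. slot (P j) (Q j) (outer_mat (n j) (x j) (y j))) k * N"
    using kron_prod_outer_mat_factorization[OF n \<phi> rk] by auto
  \<comment> \<open>A matrix is rebuilt from its \<open>n j * n j\<close> entries in row order; the
    unit vector \<open>t\<close> yields the matrix unit at
    \<open>(t div n j, t mod n j)\<close>.\<close>
  define B :: "nat \<Rightarrow> (nat \<Rightarrow> 'a) \<Rightarrow> 'a mat"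
    where "B j x = mat (n j) (n j) (\<lambda>(a, b). x (a * n j + b))" for j x
  have B: "B j x \<in> carrier_mat (n j) (n j)" for j x by (simp add: B_def)
  have B_cong: "B j x = B j y" if "\<And>t. t < n j * n j \<Longrightarrow> x t = y t" for j x y
    using that mult_add_less_mult[of _ "n j" _ "n j"] by (auto simp: B_def intro!: eq_matI)
  have B_comb: "B j (\<lambda>t. a * x t + b * y t) = a \<cdot>\<^sub>m B j x + b \<cdot>\<^sub>m B j y" for j x y a b
    by (auto simp: B_def intro!: eq_matI)
  have B_unit: "B j (unit_fun t) = outer_mat (n j) (unit_fun (t div n j)) (unit_fun (t mod n j))"
    if "t < n j * n j" for j t
  proof (rule eq_matI)
    fix a b
    assume "a < dim_row (outer_mat (n j) (unit_fun (t div n j)) (unit_fun (t mod n j)) :: 'a mat)"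
      "b < dim_col (outer_mat (n j) (unit_fun (t div n j)) (unit_fun (t mod n j)) :: 'a mat)"
    then have ab: "a < n j" "b < n j" by (simp_all add: outer_mat_def)
    have "a * n j + b = t \<longleftrightarrow> a = t div n j \<and> b = t mod n j"
      using ab by auto
    then show "B j (unit_fun t) $$ (a, b)
        = outer_mat (n j) (unit_fun (t div n j)) (unit_fun (t mod n j)) $$ (a, b)"
      using ab by (auto simp: B_def outer_mat_def unit_fun_def)
  qed (simp_all add: B_def outer_mat_def)
  let ?G = "\<lambda>w. mat_fun (\<phi> (kron_prod (\<lambda>j. B j (w j)) k))"
  let ?H = "\<lambda>w. mat_fun (M * kron_prod (\<lambda>j. slot (P j) (Q j) (B j (w j))) k * N)"
  have G: "multilinear {1..k} (\<lambda>j. n j * n j) ?G"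
    by (rule multilinear_kron_prod[OF \<phi>]) (auto intro: B B_cong B_comb)
  have H: "multilinear {1..k} (\<lambda>j. n j * n j) ?H"
  proof (rule multilinear_kron_prod[OF mat_linear_mult[OF M N]])
    show "slot (P j) (Q j) (B j (\<lambda>t. a * x t + b * y t))
        = a \<cdot>\<^sub>m slot (P j) (Q j) (B j x) + b \<cdot>\<^sub>m slot (P j) (Q j) (B j y)" for j x y a b
      unfolding B_comb by (rule slot_lincomb[OF B B])
    show "slot (P j) (Q j) (B j x) = slot (P j) (Q j) (B j y)"
      if "\<And>t. t < n j * n j \<Longrightarrow> x t = y t" for j x y
      using B_cong[OF that] by simp
  qed (rule slot_carrier[OF B])
  have GH: "?G w = ?H w" for w
  proof (rule multilinear_eqI[OF _ G H])
    fix w :: "nat \<Rightarrow> nat \<Rightarrow> 'a"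
    assume "\<And>i. i \<in> {1..k} \<Longrightarrow> \<exists>b<n i * n i. w i = unit_fun b"
    then obtain t where t: "\<And>i. i \<in> {1..k} \<Longrightarrow> t i < n i * n i \<and> w i = unit_fun (t i)"
      by metis
    let ?x = "\<lambda>j. unit_fun (t j div n j)" and ?y = "\<lambda>j. unit_fun (t j mod n j)"
    have Bw: "B j (w j) = outer_mat (n j) (?x j) (?y j)" if "j \<in> {1..k}" for j
      using t[OF that] B_unit by simp
    have "kron_prod (\<lambda>j. B j (w j)) k = kron_prod (\<lambda>j. outer_mat (n j) (?x j) (?y j)) k"
      by (rule kron_prod_cong) (rule Bw)
    moreover have "kron_prod (\<lambda>j. slot (P j) (Q j) (B j (w j))) k
        = kron_prod (\<lambda>j. slot (P j) (Q j) (outer_mat (n j) (?x j) (?y j))) k"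
      by (rule kron_prod_cong) (simp only: Bw)
    ultimately show "?G w = ?H w" using outer[of ?x ?y] by simp
  qed simp
  show ?thesis
  proof (rule exI[of _ M], rule exI[of _ N], rule exI[of _ P], rule exI[of _ Q],
      intro conjI allI impI M N)
    fix A :: "nat \<Rightarrow> 'a mat" assume "\<forall>j\<in>{1..k}. A j \<in> carrier_mat (n j) (n j)"
    then have A: "A j \<in> carrier_mat (n j) (n j)" if "j \<in> {1..k}" for j using that by blast
    let ?w = "\<lambda>j t. A j $$ (t div n j, t mod n j)"
    have BA: "B j (?w j) = A j" if "j \<in> {1..k}" for j
      using A[OF that] by (auto simp: B_def intro!: eq_matI)
    have 1: "kron_prod (\<lambda>j. B j (?w j)) k = kron_prod A k"
      by (rule kron_prod_cong) (rule BA)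
    have 2: "kron_prod (\<lambda>j. slot (P j) (Q j) (B j (?w j))) k = kron_prod (\<lambda>j. slot (P j) (Q j) (A j)) k"
      by (rule kron_prod_cong) (simp only: BA)
    have "kron_prod A k \<in> carrier_mat (\<Prod>i = 1..k. n i) (\<Prod>i = 1..k. n i)"
      using A by (rule kron_prod_carrier)
    then have "\<phi> (kron_prod A k) \<in> carrier_mat p q" using \<phi> by (simp add: mat_linear_def)
    moreover have "M * kron_prod (\<lambda>j. slot (P j) (Q j) (A j)) k * N \<in> carrier_mat p q"
      using M N by auto
    moreover have "mat_fun (\<phi> (kron_prod A k)) = mat_fun (M * kron_prod (\<lambda>j. slot (P j) (Q j) (A j)) k * N)"
      using GH[of ?w] unfolding 1 2 .
    ultimately show "\<phi> (kron_prod A k) = M * kron_prod (\<lambda>j. slot (P j) (Q j) (A j)) k * N"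
      by (intro mat_fun_inject[of _ _ p q])
  qed
qed

lemma rank_one_outer_mat:
  fixes x y :: "nat \<Rightarrow> 'a::field"
  assumes "nonzero n x" "nonzero n y"
  shows "rank_one (mat_fun (outer_mat n x y))"
proof -
  obtain p q where pq: "p < n" "x p \<noteq> 0" "q < n" "y q \<noteq> 0" using assms by (auto simp: nonzero_def)
  show ?thesis
  proof (rule rank_oneI)
    show "mat_fun (outer_mat n x y) (r, s) = (if r < n then x r else 0) * (if s < n then y s else 0)" for r s
      by (auto simp: mat_fun_apply outer_mat_def)
    show "mat_fun (outer_mat n x y) (p, q) \<noteq> 0" using pq by (simp add: mat_fun_apply outer_mat_def)
  qed
qed

text \<open>A slot both of whose vector spaces go to the same side factors through dimension one, so that
  the whole image factors through a space of dimension less than \<open>\<Prod>j. n j\<close>.\<close>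

lemma slots_distinct_if_invertible:
  fixes M N :: "'a::field mat"
  assumes n: "\<And>j. j \<in> {1..k} \<Longrightarrow> 2 \<le> n j"
    and M: "M \<in> carrier_mat (\<Prod>j = 1..k. n j) (\<Prod>j = 1..k. slot_dim (P j) (Q j) (n j))"
    and N: "N \<in> carrier_mat (\<Prod>j = 1..k. slot_dim (\<not> P j) (\<not> Q j) (n j)) (\<Prod>j = 1..k. n j)"
    and X: "\<And>j. j \<in> {1..k} \<Longrightarrow> X j \<in> carrier_mat (n j) (n j)"
    and inv: "invertible_mat (M * kron_prod (\<lambda>j. slot (P j) (Q j) (X j)) k * N)"
    and j: "j \<in> {1..k}"
  shows "P j \<noteq> Q j"
proof
  assume eq: "P j = Q j"
  let ?s = "\<lambda>j. if P j = Q j then 1 else n j"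
  let ?r = "\<lambda>j. slot_dim (P j) (Q j) (n j)" and ?c = "\<lambda>j. slot_dim (\<not> P j) (\<not> Q j) (n j)"
  \<comment> \<open>Each slot is written as \<open>P' j * Q' j\<close> with inner dimension
    \<open>?s j\<close>: a vectorized slot is a single column or row and passes through dimension 1,
    any other slot through \<open>n j\<close>.\<close>
  define P' where "P' j = (if P j \<or> Q j then slot (P j) (Q j) (X j) else 1\<^sub>m 1)" for j
  define Q' where "Q' j = (if P j \<or> Q j then 1\<^sub>m (?s j) else slot (P j) (Q j) (X j))" for j
  have PQ: "slot (P j) (Q j) (X j) = P' j * Q' j" "P' j \<in> carrier_mat (?r j) (?s j)"
      "Q' j \<in> carrier_mat (?s j) (?c j)" if "j \<in> {1..k}" for j
    using slot_carrier[OF X[OF that], of "P j" "Q j"] by (auto simp: P'_def Q'_def slot_dim_def)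
  have "kron_prod (\<lambda>j. slot (P j) (Q j) (X j)) k = kron_prod (\<lambda>j. P' j * Q' j) k"
    using PQ by (intro kron_prod_cong) auto
  also have "\<dots> = kron_prod P' k * kron_prod Q' k"
    by (rule kron_prod_mult[where r = ?r and s = ?s and t = ?c, symmetric]) (use PQ in auto)
  finally have K: "kron_prod (\<lambda>j. slot (P j) (Q j) (X j)) k = kron_prod P' k * kron_prod Q' k" .
  let ?S = "\<Prod>j = 1..k. ?s j"
  have KP: "kron_prod P' k \<in> carrier_mat (\<Prod>j = 1..k. ?r j) ?S"
    by (rule kron_prod_carrier_rect) (use PQ in auto)
  have KQ: "kron_prod Q' k \<in> carrier_mat ?S (\<Prod>j = 1..k. ?c j)"
    by (rule kron_prod_carrier_rect) (use PQ in auto)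
  have "?S < (\<Prod>j = 1..k. n j)"
  proof -
    have "(\<Prod>i\<in>{1..k} - {j}. ?s i) \<le> (\<Prod>i\<in>{1..k} - {j}. n i)"
      using n by (intro prod_mono) (auto simp: Suc_leI order.trans[OF _ n])
    moreover have "0 < (\<Prod>i\<in>{1..k} - {j}. n i)" using n by (intro prod_pos) fastforce
    moreover have "?s j * (\<Prod>i\<in>{1..k} - {j}. n i) < n j * (\<Prod>i\<in>{1..k} - {j}. n i)"
      using calculation(2) n[OF j] eq by simp
    ultimately have "?s j * (\<Prod>i\<in>{1..k} - {j}. ?s i) < n j * (\<Prod>i\<in>{1..k} - {j}. n i)"
      by (meson le_less_trans mult_le_mono2)
    then show ?thesis by (simp only: prod.remove[OF finite_atLeastAtMost j])
  qed
  moreover have "M * (kron_prod P' k * kron_prod Q' k) * N = (M * kron_prod P' k) * (kron_prod Q' k * N)"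
    unfolding assoc_mult_mat[OF M KP KQ, symmetric]
    by (rule assoc_mult_mat[OF mult_carrier_mat[OF M KP] KQ N])
  ultimately show False
    using inv not_invertible_mult_if_inner_less[OF mult_carrier_mat[OF M KP] mult_carrier_mat[OF KQ N]]
    unfolding K by simp
qed

section \<open>The equivalence\<close>

theorem corollary3p6:
  fixes k m :: nat and n :: "nat \<Rightarrow> nat" and \<phi> :: "complex mat \<Rightarrow> complex mat"
  assumes "1 \<le> k"
    and "\<forall>i \<in> {1..k}. 2 \<le> n i"
    and "m = (\<Prod>i = 1..k. n i)"
    and "linear_map class_ring (module_mat TYPE(complex) m m) (module_mat TYPE(complex) m m) \<phi>"
  shows
    "(\<forall>A. (\<forall>i \<in> {1..k}. A i \<in> carrier_mat (n i) (n i)) \<longrightarrow>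
          vec_space.rank m (kron_prod A k) = 1 \<longrightarrow> vec_space.rank m (\<phi> (kron_prod A k)) = 1) \<and>
     (\<exists>X. (\<forall>i \<in> {1..k}. X i \<in> carrier_mat (n i) (n i)) \<and> invertible_mat (\<phi> (kron_prod X k)))
     \<longleftrightarrow>
     (\<exists>M N \<psi>. M \<in> carrier_mat m m \<and> N \<in> carrier_mat m m \<and> invertible_mat M \<and> invertible_mat N \<and>
        (\<forall>j \<in> {1..k}. \<psi> j = id \<or> \<psi> j = transpose_mat) \<and>
        (\<forall>A. (\<forall>i \<in> {1..k}. A i \<in> carrier_mat (n i) (n i)) \<longrightarrow>
             \<phi> (kron_prod A k) = M * kron_prod (\<lambda>j. \<psi> j (A j)) k * N))"
    (is "?rank \<and> ?inv \<longleftrightarrow> ?form")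
proof -
  have n: "2 \<le> n i" if "i \<in> {1..k}" for i using assms(2) that by blast
  have \<phi>: "mat_linear m m m m \<phi>" by (rule mat_linear_if_linear_map[OF assms(4)])
  have K: "kron_prod A k \<in> carrier_mat m m"
    if "\<And>i. i \<in> {1..k} \<Longrightarrow> A i \<in> carrier_mat (n i) (n i)" for A :: "nat \<Rightarrow> complex mat"
    unfolding assms(3) by (rule kron_prod_carrier) (rule that)
  have \<phi>K: "\<phi> (kron_prod A k) \<in> carrier_mat m m"
    if "\<And>i. i \<in> {1..k} \<Longrightarrow> A i \<in> carrier_mat (n i) (n i)" for A
    using \<phi> K[OF that] by (simp add: mat_linear_def)
  show ?thesis
  proof
    assume "?rank \<and> ?inv"
    then have rank: ?rank and inv: ?inv by (rule conjunct1, rule conjunct2)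
    have rk: "rank_one (mat_fun (\<phi> (kron_prod (\<lambda>j. outer_mat (n j) (x j) (y j)) k)))"
      if "\<And>j. j \<in> {1..k} \<Longrightarrow> nonzero (n j) (x j) \<and> nonzero (n j) (y j)" for x y
    proof -
      let ?A = "\<lambda>j. outer_mat (n j) (x j) (y j)"
      have "rank_one (mat_fun (kron_prod ?A k))"
        using that rank_one_outer_mat unfolding rank_one_kron_prod_iff by blast
      then have "vec_space.rank m (kron_prod ?A k) = 1"
        by (simp only: rank_eq_1_iff_rank_one[OF K[OF outer_mat_carrier]])
      then have "vec_space.rank m (\<phi> (kron_prod ?A k)) = 1"
        using rank[rule_format, of ?A] by (simp add: outer_mat_carrier)
      then show ?thesis by (simp only: rank_eq_1_iff_rank_one[OF \<phi>K[OF outer_mat_carrier]])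
    qed
    obtain M P Q N where
      M: "M \<in> carrier_mat m (\<Prod>j = 1..k. slot_dim (P j) (Q j) (n j))"
      and N: "N \<in> carrier_mat (\<Prod>j = 1..k. slot_dim (\<not> P j) (\<not> Q j) (n j)) m"
      and form: "\<forall>A. (\<forall>j\<in>{1..k}. A j \<in> carrier_mat (n j) (n j)) \<longrightarrow>
        \<phi> (kron_prod A k) = M * kron_prod (\<lambda>j. slot (P j) (Q j) (A j)) k * N"
      using kron_prod_factorization[OF n \<phi>[unfolded assms(3)] rk, folded assms(3)] by auto
    obtain X where X: "\<And>i. i \<in> {1..k} \<Longrightarrow> X i \<in> carrier_mat (n i) (n i)"
      and invX: "invertible_mat (\<phi> (kron_prod X k))" using inv by blast
    have formX: "\<phi> (kron_prod X k) = M * kron_prod (\<lambda>j. slot (P j) (Q j) (X j)) k * N"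
      using form X by blast
    \<comment> \<open>One nonsingular value settles every \<open>j\<close>, since \<open>P\<close>
      and \<open>Q\<close> do not depend on the matrices.\<close>
    have PQ: "P j \<noteq> Q j" if "j \<in> {1..k}" for j
      using slots_distinct_if_invertible[OF n M[unfolded assms(3)] N[unfolded assms(3)] X _ that]
        invX formX by simp
    have dims: "(\<Prod>j = 1..k. slot_dim (P j) (Q j) (n j)) = m"
        "(\<Prod>j = 1..k. slot_dim (\<not> P j) (\<not> Q j) (n j)) = m"
      unfolding assms(3) using PQ by (auto simp: slot_dim_def intro!: prod.cong)
    define \<psi> :: "nat \<Rightarrow> complex mat \<Rightarrow> complex mat" where "\<psi> j = (if P j then id else transpose_mat)" for j
    have slot: "kron_prod (\<lambda>j. slot (P j) (Q j) (A j)) k = kron_prod (\<lambda>j. \<psi> j (A j)) k" for A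
      by (rule kron_prod_cong) (use PQ in \<open>auto simp: slot_def \<psi>_def\<close>)
    have \<psi>X: "kron_prod (\<lambda>j. \<psi> j (X j)) k \<in> carrier_mat m m"
      by (rule K) (use X in \<open>auto simp: \<psi>_def\<close>)
    have M': "M \<in> carrier_mat m m" and N': "N \<in> carrier_mat m m" using M N dims by simp_all
    \<comment> \<open>The same value makes \<open>M\<close> and \<open>N\<close> invertible: now
      that all matrices are square, its determinant splits into three factors.\<close>
    have "det (M * kron_prod (\<lambda>j. \<psi> j (X j)) k * N) \<noteq> 0"
      using invX invertible_mat_iff_det[OF \<phi>K[OF X]] formX slot by simp
    then have "invertible_mat M" "invertible_mat N"
      using M' N' \<psi>X by (auto simp: invertible_mat_iff_det det_mult[of _ m])
    moreover have "\<forall>j\<in>{1..k}. \<psi> j = id \<or> \<psi> j = transpose_mat" by (simp add: \<psi>_def)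
    ultimately show ?form using M' N' form slot by (intro exI[of _ M] exI[of _ N] exI[of _ \<psi>]) auto
  next
    assume ?form
    then obtain M N \<psi> where M: "M \<in> carrier_mat m m" and N: "N \<in> carrier_mat m m"
      and inv: "invertible_mat M" "invertible_mat N"
      and \<psi>: "\<forall>j\<in>{1..k}. \<psi> j = id \<or> \<psi> j = transpose_mat"
      and form: "\<forall>A. (\<forall>i\<in>{1..k}. A i \<in> carrier_mat (n i) (n i)) \<longrightarrow>
        \<phi> (kron_prod A k) = M * kron_prod (\<lambda>j. \<psi> j (A j)) k * N"
      by (elim exE conjE) (rule that)
    show "?rank \<and> ?inv"
    proof (intro conjI allI impI)
      fix A :: "nat \<Rightarrow> complex mat"
      assume "\<forall>i\<in>{1..k}. A i \<in> carrier_mat (n i) (n i)" and r: "vec_space.rank m (kron_prod A k) = 1"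
      then have A: "A i \<in> carrier_mat (n i) (n i)" if "i \<in> {1..k}" for i using that by blast
      have rA: "rank_one (mat_fun (A j))" if "j \<in> {1..k}" for j
        using r rank_eq_1_iff_rank_one[OF K[OF A]] that unfolding rank_one_kron_prod_iff by blast
      have "rank_one (mat_fun (\<psi> j (A j)))" if "j \<in> {1..k}" for j
        using bspec[OF \<psi> that] rA[OF that] rank_one_transpose[OF rA[OF that]] by auto
      then have "rank_one (mat_fun (kron_prod (\<lambda>j. \<psi> j (A j)) k))"
        unfolding rank_one_kron_prod_iff by blast
      moreover have "kron_prod (\<lambda>j. \<psi> j (A j)) k \<in> carrier_mat m m"
        by (rule K) (use A \<psi> in fastforce)
      moreover have eq: "\<phi> (kron_prod A k) = M * kron_prod (\<lambda>j. \<psi> j (A j)) k * N"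
        using form A by simp
      ultimately have "rank_one (mat_fun (\<phi> (kron_prod A k)))"
        unfolding eq by (intro rank_one_mult_invertible[OF M inv(1) N inv(2)])
      then show "vec_space.rank m (\<phi> (kron_prod A k)) = 1"
        using rank_eq_1_iff_rank_one[OF \<phi>K[OF A]] by blast
    next
      \<comment> \<open>Identity matrices are fixed by every \<open>\<psi> j\<close>, so the value
        of \<phi> there is \<open>M * N\<close>.\<close>
      let ?I = "\<lambda>i. 1\<^sub>m (n i) :: complex mat"
      have "kron_prod (\<lambda>j. \<psi> j (?I j)) k = kron_prod ?I k"
        by (rule kron_prod_cong) (use \<psi> in fastforce)
      also have "\<dots> = 1\<^sub>m m" unfolding assms(3) by (rule kron_prod_one)
      finally have "\<phi> (kron_prod ?I k) = M * N" using form[rule_format, of ?I] M by simp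
      then have "invertible_mat (\<phi> (kron_prod ?I k))"
        using M N inv by (simp add: invertible_mat_iff_det[of _ m] det_mult[of _ m])
      then show ?inv by (intro exI[of _ ?I]) simp
    qed
  qed
qed

end
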